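(* Let $n\geqslant 2$ and set $\alpha_n=\frac{\pi}{4}\cdot\frac{n+1}{n-1}$ if $n$ is odd and $\alpha_n=\frac{\pi}{4}\cdot\frac{n}{n-1}$ if $n$ is even. Let $p(z)=a_0z^n+a_1z^{n-1}+\dots+a_n$ be a real polynomial of degree $n$ with $a_0>0$ and $a_n>0$. If the finite Hurwitz matrix $\mathcal{H}_n(p)$ is totally nonnegative, then $p$ has no zeros in the sector $$|\arg z|<\alpha_n .$$ The constant $\alpha_n$ is sharp: for every $n\geqslant 2$ and every $\beta>\alpha_n$ there is a real polynomial of degree $n$ with positive leading coefficient and positive constant term whose finite Hurwitz matrix is totally nonnegative and which has a zero in the sector $|\arg z|<\beta$.
   Context: For a real polynomial $p(z)=a_0z^n+a_1z^{n-1}+\dots+a_n$, put $a_k=0$ for $k<0$ and $k>n$. The finite Hurwitz matrix of $p$ is the $n\times n$ matrix $\mathcal{H}_n(p)=(a_{2j-i})_{i,j=1}^n$, i.e. its first row is $(a_1,a_3,a_5,\dots)$, its second row is $(a_0,a_2,a_4,\dots)$, its third row is $(0,a_1,a_3,\dots)$, its fourth row is $(0,a_0,a_2,\dots)$, etc. A matrix is totally nonnegative if all its minors are nonnegative. For $z\neq 0$, $\arg z\in(-\pi,\pi]$ is the principal argument. *)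

theory Defs
  imports
    Complex_Main
    "HOL-Computational_Algebra.Polynomial"
    "Jordan_Normal_Form.Determinant"
    "Jordan_Normal_Form.DL_Submatrix"
begin

text \<open>
  Coefficients are numbered in descending order, \<open>p(z) = a\<^sub>0 z\<^sup>n + \<dots> + a\<^sub>n\<close> with \<open>n = degree p\<close>.
  The index is an integer because \<open>2 j - i\<close> may be negative in the Hurwitz matrix.
\<close>

definition desc_coeff :: "real poly \<Rightarrow> int \<Rightarrow> real" where
  "desc_coeff p k = (if 0 \<le> k \<and> k \<le> int (degree p) then coeff p (degree p - nat k) else 0)"

text \<open>
  Matrix indices start at 0 here, whereas the entry \<open>a\<^bsub>2 j - i\<^esub>\<close> is for \<open>i, j = 1, \<dots>, n\<close>;
  hence the shifts by 1.
\<close>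

definition hurwitz_mat :: "real poly \<Rightarrow> real mat" where
  "hurwitz_mat p = mat (degree p) (degree p)
     (\<lambda>(i, j). desc_coeff p (2 * (int j + 1) - (int i + 1)))"

definition totally_nonneg :: "real mat \<Rightarrow> bool" where
  "totally_nonneg A \<longleftrightarrow>
     (\<forall>I J. I \<subseteq> {..<dim_row A} \<and> J \<subseteq> {..<dim_col A} \<and> card I = card J
        \<longrightarrow> 0 \<le> det (submatrix A I J))"

definition sector_angle :: "nat \<Rightarrow> real" where
  "sector_angle n =
     (if odd n then pi / 4 * ((real n + 1) / (real n - 1))
      else pi / 4 * (real n / (real n - 1)))"

end

theory Submission imports Defs
begin

text \<open>
  \<^bold>\<open>The sector.\<close> Let \<open>y\<close> be the inverse of a zero of \<open>p\<close>, so \<open>\<Sum>\<^sub>k a\<^sub>k y\<^sup>k = 0\<close>, and let \<open>\<theta> = arg y\<close>,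
  where \<open>0 < \<theta>\<close> after conjugation, positive zeros being impossible as all
  coefficients are nonnegative. The parts of the sum with even and with odd \<open>k\<close> are
  opposite numbers \<open>-D\<close> and \<open>D\<close>, and every row of the Hurwitz matrix \<open>H\<close> sees only one of them:
  \<open>H\<close> maps the vector \<open>(y\<^bsup>2j+1\<^esup>)\<close>, \<open>j < n\<close>, to \<open>((-1)\<^sup>i D y\<^sup>i)\<close>, \<open>i < n\<close>. Multiplying by a complex unit
  and taking real parts gives a real vector \<open>v\<close> whose phase advances by \<open>2\<theta>\<close> at each step, so that it
  changes sign about \<open>2(n-1)\<theta>/\<pi>\<close> times, and an image \<open>Hv\<close> whose phase advances by \<open>\<theta>\<close> but which carries an
  additional factor \<open>(-1)\<^sup>i\<close>, so that it changes sign about \<open>(n-1)(1-\<theta>/\<pi>)\<close> times. A totally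
  nonnegative matrix cannot increase the number of sign changes, and if it preserves that number it
  preserves the first sign as well (\<open>tnn_variation_diminishing\<close>). With \<open>K = (n-1) div 2\<close> the angle in
  question is \<open>\<alpha>\<^sub>n = (K+1)\<pi>/(2(n-1))\<close>, and \<open>\<theta> < \<alpha>\<^sub>n\<close> means exactly that the phase of \<open>v\<close> sweeps less than
  \<open>(K+1)\<pi>\<close>. The free unit rotates both vectors simultaneously, and it can be chosen so as to
  violate variation diminution, whatever \<open>D \<noteq> 0\<close> is (\<open>tnn_no_slow_rotation\<close>).

  If \<open>D = 0\<close>, then \<open>v\<close> is in the kernel of \<open>H\<close>. The rows of \<open>H\<close> that contain the coefficients
  \<open>a\<^sub>n, a\<^bsub>n-2\<^esub>, \<dots>\<close> are \<open>K+1\<close> independent rows in echelon form, so an arbitrarily small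
  perturbation of \<open>v\<close> makes their images alternate in sign \<open>K\<close> times and begin with the wrong sign,
  while \<open>v\<close> itself can be chosen with no zero entry and at most \<open>K\<close> sign changes
  (\<open>tnn_no_slow_rotation_in_kernel\<close>).

  \<^bold>\<open>Sharpness.\<close> Let \<open>m = n div 2\<close>, and for an angle \<open>\<phi>\<close> slightly below \<open>\<pi>/(n-1)\<close> let \<open>e\<^sub>k\<close>, \<open>k \<le> m\<close>, be the
  Gaussian binomial coefficients at \<open>e\<^bsup>2i\<phi>\<^esup>\<close>, normalised to be real; they are quotients of products of sines.
  The \<open>q\<close>-binomial theorem exhibits the zeros of \<open>Q(x) = \<Sum>\<^sub>k e\<^sub>k x\<^bsup>m-k\<^esup>\<close>, the extreme ones
  having argument \<open>\<plusminus>(\<pi> - (m-1)\<phi>)\<close>, so \<open>Q(z\<^sup>2)\<close> for even \<open>n\<close> and \<open>(z+1) Q(z\<^sup>2)\<close> for odd \<open>n\<close> have a zero of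
  argument \<open>(\<pi> - (m-1)\<phi>)/2\<close>, which tends to \<open>\<alpha>\<^sub>n\<close> as \<open>\<phi>\<close> tends to \<open>\<pi>/(n-1)\<close>. The nonzero rows of their
  Hurwitz matrices are, possibly repeated, the rows of the Toeplitz matrix \<open>(e\<^bsub>j-i\<^esub>)\<close> with \<open>n\<close> columns and
  \<open>n-m\<close> rows. That matrix is totally nonnegative because, up to a positive scaling of its columns,
  its rows are nonnegative combinations of adjacent rows of the same matrix for \<open>m-1\<close>
  (\<open>sin_binom_toeplitz_tnn\<close>).
\<close>

section \<open>Families of numbers with nonnegative minors\<close>

text \<open>
  Matrices are handled as index functions, with minors selected by increasing maps: this makes
  passing to submatrices, merging columns and adding rows a matter of substitution.
\<close>
definition square_det :: "nat \<Rightarrow> (nat \<Rightarrow> nat \<Rightarrow> real) \<Rightarrow> real" where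
  "square_det s F = det (mat s s (\<lambda>(a, b). F a b))"

definition tnn :: "nat \<Rightarrow> nat \<Rightarrow> (nat \<Rightarrow> nat \<Rightarrow> real) \<Rightarrow> bool" where
  "tnn R C A \<longleftrightarrow> (\<forall>s f g. strict_mono_on {..<s} f \<and> strict_mono_on {..<s} g
     \<and> f ` {..<s} \<subseteq> {..<R} \<and> g ` {..<s} \<subseteq> {..<C}
     \<longrightarrow> 0 \<le> square_det s (\<lambda>a b. A (f a) (g b)))"

lemma square_det_cong:
  assumes "\<And>a b. a < s \<Longrightarrow> b < s \<Longrightarrow> F a b = G a b"
  shows "square_det s F = square_det s G"
proof -
  have "mat s s (\<lambda>(a, b). F a b) = mat s s (\<lambda>(a, b). G a b)"
    using assms by (intro eq_matI) auto
  then show ?thesis by (simp add: square_det_def)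
qed

lemma square_det_transpose: "square_det s (\<lambda>a b. F b a) = square_det s F"
proof -
  have "mat s s (\<lambda>(a, b). F b a) = transpose_mat (mat s s (\<lambda>(a, b). F a b))"
    by (intro eq_matI) auto
  then show ?thesis
    by (simp add: square_det_def det_transpose[of _ s])
qed

lemma square_det_laplace_row:
  assumes "t < s"
  shows "square_det s F = (\<Sum>b<s. F t b * ((-1) ^ (t + b) *
     square_det (s - 1) (\<lambda>a' b'. F (if a' < t then a' else Suc a') (if b' < b then b' else Suc b'))))"
proof -
  have "square_det s F = (\<Sum>b<s. mat s s (\<lambda>(a, b). F a b) $$ (t, b)
      * cofactor (mat s s (\<lambda>(a, b). F a b)) t b)"
    unfolding square_det_def using assms by (intro laplace_expansion_row) auto
  also have "\<dots> = (\<Sum>b<s. F t b * ((-1) ^ (t + b) *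
     square_det (s - 1) (\<lambda>a' b'. F (if a' < t then a' else Suc a') (if b' < b then b' else Suc b'))))"
  proof (rule sum.cong)
    fix b assume "b \<in> {..<s}"
    then have b: "b < s" by simp
    have "mat_delete (mat s s (\<lambda>(a, b). F a b)) t b = mat (s - 1) (s - 1)
       (\<lambda>(a', b'). F (if a' < t then a' else Suc a') (if b' < b then b' else Suc b'))"
      unfolding mat_delete_def using assms b by (intro eq_matI) auto
    then show "mat s s (\<lambda>(a, b). F a b) $$ (t, b) * cofactor (mat s s (\<lambda>(a, b). F a b)) t b =
        F t b * ((-1) ^ (t + b) * square_det (s - 1)
          (\<lambda>a' b'. F (if a' < t then a' else Suc a') (if b' < b then b' else Suc b')))"
      using assms b by (simp add: cofactor_def square_det_def)
  qed simp
  finally show ?thesis .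
qed

lemma square_det_row_sum:
  assumes "t < s" 
  shows "square_det s (\<lambda>a b. if a = t then (\<Sum>l\<in>S. c l * G l b) else F a b)
       = (\<Sum>l\<in>S. c l * square_det s (\<lambda>a b. if a = t then G l b else F a b))"
proof -
  let ?D = "\<lambda>b. (-1) ^ (t + b) * square_det (s - 1)
     (\<lambda>a' b'. F (if a' < t then a' else Suc a') (if b' < b then b' else Suc b'))"
  have exp: "square_det s (\<lambda>a b. if a = t then H b else F a b) = (\<Sum>b<s. H b * ?D b)" for H
    by (subst square_det_laplace_row[OF assms], intro sum.cong arg_cong2[where f="(*)"] square_det_cong refl)
      auto
  have "(\<Sum>b<s. (\<Sum>l\<in>S. c l * G l b) * ?D b) = (\<Sum>b<s. \<Sum>l\<in>S. c l * (G l b * ?D b))"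
    by (simp add: sum_distrib_right mult.assoc)
  also have "\<dots> = (\<Sum>l\<in>S. \<Sum>b<s. c l * (G l b * ?D b))" by (rule sum.swap)
  also have "\<dots> = (\<Sum>l\<in>S. c l * (\<Sum>b<s. G l b * ?D b))" by (simp add: sum_distrib_left)
  finally show ?thesis by (simp only: exp)
qed

lemma square_det_equal_rows:
  assumes "a < s" "a' < s" "a \<noteq> a'" "\<And>b. b < s \<Longrightarrow> F a b = F a' b"
  shows "square_det s F = 0"
  unfolding square_det_def using assms
  by (intro det_identical_rows[of _ s a a']) (auto intro!: eq_vecI)

lemma square_det_zero_row:
  assumes "t < s" "\<And>b. b < s \<Longrightarrow> F t b = 0"
  shows "square_det s F = 0"
  by (subst square_det_laplace_row[OF assms(1)]) (simp add: assms(2))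

lemma tnn_transpose: "tnn R C A \<Longrightarrow> tnn C R (\<lambda>j i. A i j)"
  unfolding tnn_def
proof (intro allI impI, elim conjE)
  fix s :: nat and f g :: "nat \<Rightarrow> nat"
  assume *: "\<forall>s f g. strict_mono_on {..<s} f \<and> strict_mono_on {..<s} g \<and> f ` {..<s} \<subseteq> {..<R} \<and> g ` {..<s} \<subseteq> {..<C}
     \<longrightarrow> 0 \<le> square_det s (\<lambda>a b. A (f a) (g b))"
   and "strict_mono_on {..<s} f" "strict_mono_on {..<s} g" "f ` {..<s} \<subseteq> {..<C}" "g ` {..<s} \<subseteq> {..<R}"
  then have "0 \<le> square_det s (\<lambda>a b. A (g a) (f b))" by blast
  then show "0 \<le> square_det s (\<lambda>a b. A (g b) (f a))"
    by (subst square_det_transpose)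
qed

lemma tnn_submatrix:
  assumes "tnn R C A" "strict_mono_on {..<R'} \<rho>" "strict_mono_on {..<C'} \<gamma>"
    "\<rho> ` {..<R'} \<subseteq> {..<R}" "\<gamma> ` {..<C'} \<subseteq> {..<C}"
  shows "tnn R' C' (\<lambda>i j. A (\<rho> i) (\<gamma> j))"
  unfolding tnn_def
proof (intro allI impI, elim conjE)
  fix s :: nat and f g :: "nat \<Rightarrow> nat"
  assume f: "strict_mono_on {..<s} f" "f ` {..<s} \<subseteq> {..<R'}"
    and g: "strict_mono_on {..<s} g" "g ` {..<s} \<subseteq> {..<C'}"
  have "strict_mono_on {..<s} (\<rho> \<circ> f)" "strict_mono_on {..<s} (\<gamma> \<circ> g)"
    using assms(2,3) f g unfolding strict_mono_on_def by (auto simp: image_subset_iff)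
  moreover have "(\<rho> \<circ> f) ` {..<s} \<subseteq> {..<R}" "(\<gamma> \<circ> g) ` {..<s} \<subseteq> {..<C}"
    using assms(4,5) f g by (auto simp: image_subset_iff)
  ultimately have "0 \<le> square_det s (\<lambda>a b. A ((\<rho> \<circ> f) a) ((\<gamma> \<circ> g) b))"
    using assms(1) unfolding tnn_def by blast
  then show "0 \<le> square_det s (\<lambda>a b. A (\<rho> (f a)) (\<gamma> (g b)))" by simp
qed

lemma tnn_entry_nonneg:
  assumes "tnn R C A" "i < R" "j < C"
  shows "0 \<le> A i j"
proof -
  have "strict_mono_on {..<Suc 0} (\<lambda>_. i)" "strict_mono_on {..<Suc 0} (\<lambda>_. j)"
    by (auto intro: strict_mono_onI)
  moreover have "(\<lambda>_. i) ` {..<Suc 0} \<subseteq> {..<R}" "(\<lambda>_. j) ` {..<Suc 0} \<subseteq> {..<C}"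
    using assms by auto
  ultimately have "0 \<le> square_det (Suc 0) (\<lambda>_ _. A i j)" using assms(1) unfolding tnn_def by blast
  then show ?thesis by (simp add: square_det_def det_single)
qed

text \<open>
  Expanding a minor of \<open>B\<close> by multilinearity in its rows gives a nonnegative combination of determinants
  formed from rows of \<open>A\<close>. As the blocks \<open>S i\<close> follow each other, sharing end points at most, the rows
  in each of these determinants are in weakly increasing order; so it is a minor of \<open>A\<close>, or it has two
  equal rows and vanishes. Applied to transposes, the lemma also merges blocks of columns.
\<close>
lemma tnn_row_combination:
  assumes A: "tnn R C A"
    and B: "\<And>i j. i < R' \<Longrightarrow> j < C \<Longrightarrow> B i j = (\<Sum>l\<in>S i. c i l * A l j)"
    and c: "\<And>i l. i < R' \<Longrightarrow> l \<in> S i \<Longrightarrow> 0 \<le> c i l"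
    and S: "\<And>i. i < R' \<Longrightarrow> S i \<subseteq> {..<R}"
    and ord: "\<And>i i' l l'. i < i' \<Longrightarrow> i' < R' \<Longrightarrow> l \<in> S i \<Longrightarrow> l' \<in> S i' \<Longrightarrow> l \<le> l'"
  shows "tnn R' C B"
  unfolding tnn_def
proof (intro allI impI, elim conjE)
  fix s :: nat and f g :: "nat \<Rightarrow> nat"
  assume f: "strict_mono_on {..<s} f" "f ` {..<s} \<subseteq> {..<R'}"
    and g: "strict_mono_on {..<s} g" "g ` {..<s} \<subseteq> {..<C}"
  have fR: "f a < R'" and gC: "g a < C" if "a < s" for a using f g that by auto
  have fm: "f a < f a'" if "a < a'" "a' < s" for a a'
    using strict_mono_onD[OF f(1)] that by auto
  have "0 \<le> square_det s (\<lambda>a b. if a < t then B (f a) (g b) else A (ch a) (g b))"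
    if "t \<le> s" "\<And>a. a < s \<Longrightarrow> ch a \<in> S (f a)" for t ch
    using that
  proof (induction t arbitrary: ch)
    case 0
    have le: "ch a \<le> ch a'" if "a < a'" "a' < s" for a a'
      using ord[OF fm[OF that] fR[OF that(2)]] 0(2) that by auto
    show ?case
    proof (cases "strict_mono_on {..<s} ch")
      case True
      moreover have "ch ` {..<s} \<subseteq> {..<R}" using 0(2) S fR by blast
      ultimately show ?thesis using A g unfolding tnn_def by simp
    next
      case False
      then obtain a a' where a: "a < a'" "a' < s" "\<not> ch a < ch a'"
        unfolding strict_mono_on_def by auto
      then have "ch a = ch a'" using le[OF a(1,2)] by simp
      then have "square_det s (\<lambda>a b. A (ch a) (g b)) = 0"
        using a by (intro square_det_equal_rows[of a s a']) auto
      then show ?thesis by simp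
    qed
  next
    case (Suc t)
    let ?F = "\<lambda>a b. if a < t then B (f a) (g b) else A (ch a) (g b)"
    have "square_det s (\<lambda>a b. if a < Suc t then B (f a) (g b) else A (ch a) (g b))
        = square_det s (\<lambda>a b. if a = t then (\<Sum>l\<in>S (f t). c (f t) l * A l (g b)) else ?F a b)"
      using Suc.prems(1) fR gC by (intro square_det_cong) (auto simp: B less_Suc_eq)
    also have "\<dots> = (\<Sum>l\<in>S (f t). c (f t) l * square_det s (\<lambda>a b. if a = t then A l (g b) else ?F a b))"
      using Suc.prems(1) by (intro square_det_row_sum) auto
    also have "\<dots> \<ge> 0"
    proof (intro sum_nonneg mult_nonneg_nonneg)
      fix l assume l: "l \<in> S (f t)"
      show "0 \<le> c (f t) l" using c l fR Suc.prems(1) by auto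
      have "0 \<le> square_det s (\<lambda>a b. if a < t then B (f a) (g b) else A ((ch(t := l)) a) (g b))"
        using Suc.prems l by (intro Suc.IH) auto
      also have "\<dots> = square_det s (\<lambda>a b. if a = t then A l (g b) else ?F a b)"
        by (intro square_det_cong) auto
      finally show "0 \<le> square_det s (\<lambda>a b. if a = t then A l (g b) else ?F a b)" .
    qed
    finally show ?case .
  qed
  note main = this
  show "0 \<le> square_det s (\<lambda>a b. B (f a) (g b))"
  proof (cases "\<exists>a<s. S (f a) = {}")
    case True
    then obtain a where a: "a < s" "S (f a) = {}" by auto
    then have "square_det s (\<lambda>a b. B (f a) (g b)) = 0"
      using B fR gC by (intro square_det_zero_row[of a]) auto
    then show ?thesis by simp
  next
    case False
    then have "\<forall>a. \<exists>l. a < s \<longrightarrow> l \<in> S (f a)" by blast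
    then obtain ch where "\<And>a. a < s \<Longrightarrow> ch a \<in> S (f a)" by metis
    from main[OF order_refl this] have "0 \<le> square_det s (\<lambda>a b. if a < s then B (f a) (g b) else A (ch a) (g b))" .
    also have "\<dots> = square_det s (\<lambda>a b. B (f a) (g b))" by (intro square_det_cong) auto
    finally show ?thesis .
  qed
qed

lemma totally_nonneg_mat_iff:
  "totally_nonneg (mat R C (\<lambda>(i, j). A i j)) \<longleftrightarrow> tnn R C A" (is "?L \<longleftrightarrow> ?R")
proof
  assume L: ?L
  show ?R unfolding tnn_def
  proof (intro allI impI, elim conjE)
    fix s :: nat and f g :: "nat \<Rightarrow> nat"
    assume f: "strict_mono_on {..<s} f" "f ` {..<s} \<subseteq> {..<R}"
      and g: "strict_mono_on {..<s} g" "g ` {..<s} \<subseteq> {..<C}"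
    have inj: "inj_on f {..<s}" "inj_on g {..<s}" using f g strict_mono_on_imp_inj_on by blast+
    have pick: "pick (h ` {..<s}) a = h a" if h: "strict_mono_on {..<s} h" and a: "a < s" for h :: "nat \<Rightarrow> nat" and a
    proof -
      have "inj_on h {..<s}" using h strict_mono_on_imp_inj_on by blast
      then have injs: "inj_on h {..<a}" using a by (auto intro: inj_on_subset)
      have iff: "h x < h a \<longleftrightarrow> x < a" if "x < s" for x
        using strict_mono_on_less[OF h, of x a] a that by simp
      have "{x \<in> h ` {..<s}. x < h a} = h ` {..<a}" using iff a by auto
      then have "card {x \<in> h ` {..<s}. x < h a} = a" using injs by (simp add: card_image)
      then show ?thesis using pick_card_in_set[of "h a" "h ` {..<s}"] a by simp
    qed
    let ?I = "f ` {..<s}" and ?J = "g ` {..<s}" and ?M = "mat R C (\<lambda>(i, j). A i j)"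
    have "{i. i < R \<and> i \<in> ?I} = ?I" "{i. i < C \<and> i \<in> ?J} = ?J" using f g by auto
    then have card: "card {i. i < R \<and> i \<in> ?I} = s" "card {i. i < C \<and> i \<in> ?J} = s"
      using inj by (simp_all add: card_image)
    have "card ?I = card ?J" using inj by (simp add: card_image)
    then have "0 \<le> det (submatrix ?M ?I ?J)" using L f g unfolding totally_nonneg_def by auto
    also have "submatrix ?M ?I ?J = mat s s (\<lambda>(a, b). A (f a) (g b))"
      unfolding submatrix_def using card f g pick
      by (intro eq_matI) (auto simp: image_subset_iff)
    finally show "0 \<le> square_det s (\<lambda>a b. A (f a) (g b))" by (simp add: square_det_def)
  qed
next
  assume A: ?R
  show ?L unfolding totally_nonneg_def
  proof (intro allI impI, elim conjE)
    fix I J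
    let ?M = "mat R C (\<lambda>(i, j). A i j)"
    assume I: "I \<subseteq> {..<dim_row ?M}" and J: "J \<subseteq> {..<dim_col ?M}" and eq: "card I = card J"
    have IJ: "I \<subseteq> {..<R}" "J \<subseteq> {..<C}" using I J by auto
    have "{i. i < R \<and> i \<in> I} = I" "{i. i < C \<and> i \<in> J} = J" using IJ by auto
    then have card: "card {i. i < R \<and> i \<in> I} = card I" "card {i. i < C \<and> i \<in> J} = card I"
      using eq by simp_all
    have p: "pick I ` {..<card I} \<subseteq> I" "pick J ` {..<card I} \<subseteq> J"
      using eq by (auto intro: pick_in_set_le)
    have "0 \<le> square_det (card I) (\<lambda>a b. A (pick I a) (pick J b))"
      using p IJ eq
      by (intro A[unfolded tnn_def, rule_format] conjI strict_mono_onI) (auto intro: pick_mono_le)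
    also have "\<dots> = det (submatrix ?M I J)"
      unfolding square_det_def submatrix_def using card p IJ
      by (intro arg_cong[where f=det] eq_matI) (auto simp: image_subset_iff subset_iff)
    finally show "0 \<le> det (submatrix ?M I J)" .
  qed
qed

section \<open>Variation diminution\<close>

lemma square_det_laplace_last_col:
  "square_det (Suc g) F = (\<Sum>k\<le>g. (-1) ^ (g + k) * F k g *
     square_det g (\<lambda>a b. F (if a < k then a else Suc a) b))"
proof -
  have "square_det (Suc g) F = square_det (Suc g) (\<lambda>a b. F b a)"
    by (rule square_det_transpose[symmetric])
  also have "\<dots> = (\<Sum>k<Suc g. F k g * ((-1) ^ (g + k) *
      square_det g (\<lambda>a' b'. F (if b' < k then b' else Suc b') (if a' < g then a' else Suc a'))))"
    by (subst square_det_laplace_row[of g]) auto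
  also have "\<dots> = (\<Sum>k<Suc g. (-1) ^ (g + k) * F k g *
      square_det g (\<lambda>a b. F (if a < k then a else Suc a) b))"
  proof (intro sum.cong refl)
    fix k
    have "square_det g (\<lambda>a' b'. F (if b' < k then b' else Suc b') (if a' < g then a' else Suc a'))
       = square_det g (\<lambda>a' b'. (\<lambda>a b. F (if a < k then a else Suc a) b) b' a')"
      by (intro square_det_cong) auto
    also have "\<dots> = square_det g (\<lambda>a b. F (if a < k then a else Suc a) b)"
      by (rule square_det_transpose)
    finally show "F k g * ((-1) ^ (g + k) * square_det g (\<lambda>a' b'. F (if b' < k then b' else Suc b') (if a' < g then a' else Suc a')))
      = (-1) ^ (g + k) * F k g * square_det g (\<lambda>a b. F (if a < k then a else Suc a) b)"
      by simp
  qed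
  finally show ?thesis by (simp add: lessThan_Suc_atMost)
qed

lemma square_det_eq_0_iff:
  "square_det s F = 0 \<longleftrightarrow> (\<exists>x. (\<exists>j<s. x j \<noteq> 0) \<and> (\<forall>i<s. (\<Sum>j<s. F i j * x j) = 0))"
    (is "_ \<longleftrightarrow> ?R")
proof -
  let ?M = "mat s s (\<lambda>(a, b). F a b)"
  have *: "(?M *\<^sub>v v) $ i = (\<Sum>j<s. F i j * v $ j)" if "i < s" "v \<in> carrier_vec s" for v i
    using that by (auto simp: scalar_prod_def lessThan_atLeast0 intro!: sum.cong)
  have "square_det s F = 0 \<longleftrightarrow> (\<exists>v. v \<in> carrier_vec s \<and> v \<noteq> 0\<^sub>v s \<and> ?M *\<^sub>v v = 0\<^sub>v s)"
    unfolding square_det_def by (rule det_0_iff_vec_prod_zero) simp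
  also have "\<dots> \<longleftrightarrow> ?R"
  proof
    assume "\<exists>v. v \<in> carrier_vec s \<and> v \<noteq> 0\<^sub>v s \<and> ?M *\<^sub>v v = 0\<^sub>v s"
    then obtain v where v: "v \<in> carrier_vec s" "v \<noteq> 0\<^sub>v s" "?M *\<^sub>v v = 0\<^sub>v s" by blast
    have "\<exists>j<s. v $ j \<noteq> 0"
    proof (rule ccontr)
      assume "\<not> ?thesis"
      then have "v = 0\<^sub>v s" using v(1) by (intro eq_vecI) auto
      then show False using v(2) by simp
    qed
    moreover have "(\<Sum>j<s. F i j * v $ j) = 0" if "i < s" for i
      using *[OF that v(1)] v(3) that by simp
    ultimately show ?R by blast
  next
    assume ?R
    then obtain x j where x: "j < s" "x j \<noteq> 0" "\<forall>i<s. (\<Sum>j<s. F i j * x j) = 0" by blast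
    have "vec s x \<noteq> 0\<^sub>v s"
    proof
      assume "vec s x = 0\<^sub>v s"
      then have "vec s x $ j = 0\<^sub>v s $ j" by simp
      then show False using x by simp
    qed
    moreover have "?M *\<^sub>v vec s x = 0\<^sub>v s"
    proof (rule eq_vecI)
      fix i assume "i < dim_vec (0\<^sub>v s :: real vec)"
      then have i: "i < s" by simp
      show "(?M *\<^sub>v vec s x) $ i = 0\<^sub>v s $ i" using *[OF i, of "vec s x"] x(3) i by simp
    qed simp
    ultimately show "\<exists>v. v \<in> carrier_vec s \<and> v \<noteq> 0\<^sub>v s \<and> ?M *\<^sub>v v = 0\<^sub>v s"
      by (intro exI[of _ "vec s x"]) simp
  qed
  finally show ?thesis .
qed

lemma sum_delete_index:
  fixes q :: nat
  assumes "q < Suc g"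
  shows "(\<Sum>j<Suc g. h j) = (h q :: real) + (\<Sum>j<g. h (if j < q then j else Suc j))"
proof -
  have 1: "(\<Sum>j<g. h (if j < q then j else Suc j)) = sum h ((\<lambda>j. if j < q then j else Suc j) ` {..<g})"
    by (subst sum.reindex) (auto simp: inj_on_def)
  have 2: "(\<lambda>j. if j < q then j else Suc j) ` {..<g} = {..<Suc g} - {q}" (is "?f ` _ = _")
  proof (rule subset_antisym; rule subsetI)
    fix x assume "x \<in> {..<Suc g} - {q}"
    then have "x = ?f (if x < q then x else x - 1)" "(if x < q then x else x - 1) < g"
      using assms by auto
    then show "x \<in> ?f ` {..<g}" by blast
  qed (use assms in \<open>auto split: if_splits\<close>)
  show ?thesis unfolding 1 2 using assms by (simp add: sum.remove[of _ q] del: sum.lessThan_Suc)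
qed

text \<open>
  The image of a \<open>g\<close>-dimensional space cannot alternate \<open>g\<close> times. If the top square minor is positive,
  adjoin \<open>u = B w\<close> to \<open>B\<close> as a last column: the determinant vanishes, but its expansion along that column is a
  sum of terms of equal sign, one of which is nonzero. If the top minor is zero, a vector in the
  kernel of the first \<open>g\<close> rows can be subtracted from \<open>w\<close> so as to cancel one entry; this loses one
  column and one row, and induction applies.
\<close>
lemma tnn_no_full_alternation:
  assumes "tnn (Suc g) g B" "\<And>k. k \<le> g \<Longrightarrow> 0 < (-1) ^ k * (\<Sum>j<g. B k j * w j)"
  shows False
  using assms
proof (induction g arbitrary: B w)
  case 0
  then show ?case by simp
next
  case (Suc g)
  define u where "u k = (\<Sum>j<Suc g. B k j * w j)" for k
  have u: "0 < (-1) ^ k * u k" if "k \<le> Suc g" for k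
    using Suc.prems(2)[OF that] by (simp add: u_def)
  have id: "strict_mono_on {..<t} (\<lambda>a. a)" for t :: nat by (simp add: strict_mono_on_def)
  have minors: "0 \<le> square_det (Suc g) (\<lambda>a b. B (if a < k then a else Suc a) b)" if "k \<le> Suc g" for k
  proof -
    have "strict_mono_on {..<Suc g} (\<lambda>a. if a < k then a else Suc a)"
      "(\<lambda>a. if a < k then a else Suc a) ` {..<Suc g} \<subseteq> {..<Suc (Suc g)}"
      by (auto simp: strict_mono_on_def)
    then show ?thesis using Suc.prems(1)[unfolded tnn_def, rule_format, of "Suc g" "\<lambda>a. if a < k then a else Suc a" "\<lambda>a. a"] id by simp
  qed
  show False
  proof (cases "square_det (Suc g) B = 0")
    case True
    then obtain x q where q: "q < Suc g" "x q \<noteq> 0"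
      and x: "\<And>i. i < Suc g \<Longrightarrow> (\<Sum>j<Suc g. B i j * x j) = 0"
      unfolding square_det_eq_0_iff by blast
    \<comment> \<open>Only the images under the first \<open>g + 1\<close> rows are preserved; the last row is given up.\<close>
    define w' where "w' j = w j - w q / x q * x j" for j
    have w'q: "w' q = 0" using q by (simp add: w'_def)
    let ?d = "\<lambda>j. if j < q then j else Suc j"
    have d: "strict_mono_on {..<g} ?d" "?d ` {..<g} \<subseteq> {..<Suc g}" using q
      by (auto simp: strict_mono_on_def)
    have u': "u k = (\<Sum>j<g. B k (?d j) * w' (?d j))" if "k < Suc g" for k
    proof -
      have "(\<Sum>j<Suc g. B k j * w' j) = u k - w q / x q * (\<Sum>j<Suc g. B k j * x j)"
        unfolding w'_def u_def by (simp only: right_diff_distrib sum_subtractf sum_distrib_left mult.left_commute)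
      then have "u k = (\<Sum>j<Suc g. B k j * w' j)" using x[OF that] by simp
      also have "\<dots> = (\<Sum>j<g. B k (?d j) * w' (?d j))"
        by (subst sum_delete_index[OF q(1)]) (simp add: w'q)
      finally show ?thesis .
    qed
    show False
    proof (rule Suc.IH)
      show "tnn (Suc g) g (\<lambda>k j. B k (?d j))"
        using tnn_submatrix[OF Suc.prems(1), of "Suc g" "\<lambda>a. a" g ?d] id d by auto
      show "0 < (-1) ^ k * (\<Sum>j<g. B k (?d j) * w' (?d j))" if "k \<le> g" for k
        using u[of k] u'[of k] that by simp
    qed
  next
    case False
    let ?E = "\<lambda>a b. if b < Suc g then B a b else u a"
    have "square_det (Suc (Suc g)) ?E = 0"
      unfolding square_det_eq_0_iff
      by (rule exI[of _ "\<lambda>j. if j < Suc g then w j else -1"])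
        (auto simp: u_def intro!: exI[of _ "Suc g"])
    then have "0 = (\<Sum>k\<le>Suc g. (-1) ^ (Suc g + k) * u k *
       square_det (Suc g) (\<lambda>a b. B (if a < k then a else Suc a) b))"
      by (simp add: square_det_laplace_last_col[of "Suc g" ?E] del: sum.atMost_Suc cong: square_det_cong)
    then have "0 = (-1) ^ Suc g * (\<Sum>k\<le>Suc g. (-1) ^ (Suc g + k) * u k *
       square_det (Suc g) (\<lambda>a b. B (if a < k then a else Suc a) b))" by simp
    also have "\<dots> = (\<Sum>k\<le>Suc g. ((-1) ^ k * u k) *
       square_det (Suc g) (\<lambda>a b. B (if a < k then a else Suc a) b))"
      by (simp add: sum_distrib_left power_add mult.assoc[symmetric] power_mult_distrib[symmetric] del: sum.atMost_Suc)
    also have "\<dots> > 0"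
    proof (rule sum_pos2[of _ "Suc g"])
      have "square_det (Suc g) (\<lambda>a b. B (if a < Suc g then a else Suc a) b) = square_det (Suc g) B"
        by (intro square_det_cong) auto
      then show "0 < ((-1) ^ Suc g * u (Suc g)) * square_det (Suc g) (\<lambda>a b. B (if a < Suc g then a else Suc a) b)"
        using False minors[of "Suc g"] by (intro mult_pos_pos u) simp_all
      show "0 \<le> (-1) ^ k * u k * square_det (Suc g) (\<lambda>a b. B (if a < k then a else Suc a) b)"
        if "k \<in> {..Suc g}" for k
        by (rule mult_nonneg_nonneg) (use that minors[of k] u[of k] in \<open>auto intro: less_imp_le\<close>)
    qed auto
    finally show False by simp
  qed
qed

text \<open>
  With the extra row, the image of a vector begins with a copy of the first entry of that
  vector. This is how statements on numbers of sign changes acquire information on the first sign.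
\<close>
lemma tnn_unit_row_on_top:
  assumes A: "tnn R C A"
  shows "tnn (Suc R) C (\<lambda>i j. case i of 0 \<Rightarrow> (if j = 0 then 1 else 0) | Suc i' \<Rightarrow> A i' j)"
    (is "tnn _ _ ?A")
  unfolding tnn_def
proof (intro allI impI, elim conjE)
  fix s :: nat and f g :: "nat \<Rightarrow> nat"
  assume f: "strict_mono_on {..<s} f" "f ` {..<s} \<subseteq> {..<Suc R}"
    and g: "strict_mono_on {..<s} g" "g ` {..<s} \<subseteq> {..<C}"
  have fm: "f a < f a'" if "a < a'" "a' < s" for a a'
    using strict_mono_onD[OF f(1)] that by auto
  have gm: "g a < g a'" if "a < a'" "a' < s" for a a'
    using strict_mono_onD[OF g(1)] that by auto
  show "0 \<le> square_det s (\<lambda>a b. ?A (f a) (g b))"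
  proof (cases "0 < s \<and> f 0 = 0")
    case False
    have pos: "0 < f a" if "a < s" for a
    proof (cases a)
      case 0 then show ?thesis using False that by auto
    next
      case (Suc a') then show ?thesis using fm[of 0 a] that by auto
    qed
    have "strict_mono_on {..<s} (\<lambda>a. f a - 1)"
    proof (rule strict_mono_onI)
      fix a a' assume "a \<in> {..<s}" "a' \<in> {..<s}" "a < a'"
      then show "f a - 1 < f a' - 1" using fm[of a a'] pos[of a] by auto
    qed
    moreover have "(\<lambda>a. f a - 1) ` {..<s} \<subseteq> {..<R}" using f(2) pos by (fastforce simp: image_subset_iff)
    ultimately have "0 \<le> square_det s (\<lambda>a b. A (f a - 1) (g b))" using A g unfolding tnn_def by blast
    also have "\<dots> = square_det s (\<lambda>a b. ?A (f a) (g b))"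
      using pos by (intro square_det_cong) (force split: nat.split)
    finally show ?thesis .
  next
    case True
    then obtain s' where s': "s = Suc s'" using gr0_implies_Suc by blast
    have "square_det s (\<lambda>a b. ?A (f a) (g b)) = (if g 0 = 0 then 1 else 0) *
       square_det s' (\<lambda>a b. ?A (f (Suc a)) (g (Suc b)))"
    proof -
      let ?D = "\<lambda>b. (-1) ^ (0 + b) * square_det (s - 1)
        (\<lambda>a' b'. ?A (f (if a' < 0 then a' else Suc a')) (g (if b' < b then b' else Suc b')))"
      have g0: "g (Suc b) \<noteq> 0" if "b < s'" for b using gm[of 0 "Suc b"] that s' by auto
      have "square_det s (\<lambda>a b. ?A (f a) (g b)) = (\<Sum>b<Suc s'. ?A (f 0) (g b) * ?D b)"
        using True by (subst square_det_laplace_row[of 0]) (simp_all only: s')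
      also have "\<dots> = ?A (f 0) (g 0) * ?D 0 + (\<Sum>b<s'. ?A (f 0) (g (Suc b)) * ?D (Suc b))"
        by (rule sum.lessThan_Suc_shift)
      also have "(\<Sum>b<s'. ?A (f 0) (g (Suc b)) * ?D (Suc b)) = 0"
        using True by (intro sum.neutral ballI) (auto dest: g0)
      finally show ?thesis using True by (simp add: s' cong: nat.case_cong)
    qed
    moreover have "0 \<le> square_det s' (\<lambda>a b. ?A (f (Suc a)) (g (Suc b)))"
    proof -
      have pos: "0 < f (Suc a)" if "a < s'" for a using fm[of 0 "Suc a"] that s' by auto
      have "strict_mono_on {..<s'} (\<lambda>a. f (Suc a) - 1)"
      proof (rule strict_mono_onI)
        fix a a' assume "a \<in> {..<s'}" "a' \<in> {..<s'}" "a < a'"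
        then show "f (Suc a) - 1 < f (Suc a') - 1" using fm[of "Suc a" "Suc a'"] pos[of a] s' by auto
      qed
      moreover have "strict_mono_on {..<s'} (\<lambda>a. g (Suc a))"
        by (rule strict_mono_onI) (use gm s' in auto)
      moreover have "(\<lambda>a. f (Suc a) - 1) ` {..<s'} \<subseteq> {..<R}" "(\<lambda>a. g (Suc a)) ` {..<s'} \<subseteq> {..<C}"
        using f(2) g(2) pos s' by (fastforce simp: image_subset_iff)+
      ultimately have "0 \<le> square_det s' (\<lambda>a b. A (f (Suc a) - 1) (g (Suc b)))"
        using A unfolding tnn_def by blast
      also have "\<dots> = square_det s' (\<lambda>a b. ?A (f (Suc a)) (g (Suc b)))"
        using pos by (intro square_det_cong) (force split: nat.split)
      finally show ?thesis .
    qed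
    ultimately show ?thesis by simp
  qed
qed

text \<open>
  The map \<open>h\<close> cuts \<open>v\<close> into at most \<open>K + 1\<close> consecutive blocks of constant sign, the first one
  positive. If the image alternated \<open>K\<close> times beginning with a negative sign, then together with the copy
  of \<open>v 0\<close> provided by the extra row it would alternate \<open>K + 1\<close> times; but merging the columns of each block
  leaves a matrix with \<open>K + 1\<close> columns only.
\<close>
lemma tnn_variation_diminishing:
  fixes h :: "nat \<Rightarrow> nat" and v :: "nat \<Rightarrow> real"
  assumes A: "tnn R C A" and C: "0 < C"
    and h: "\<And>j j'. j \<le> j' \<Longrightarrow> j' < C \<Longrightarrow> h j \<le> h j'" "\<And>j. j < C \<Longrightarrow> h j \<le> K"
    and v: "\<And>j. j < C \<Longrightarrow> 0 \<le> (-1) ^ h j * v j" "0 < v 0"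
    and idx: "strict_mono_on {..K} idx" "idx ` {..K} \<subseteq> {..<R}"
    and neg: "\<And>k. k \<le> K \<Longrightarrow> (-1) ^ k * (\<Sum>j<C. A (idx k) j * v j) < 0"
  shows False
proof -
  let ?A = "\<lambda>i j. case i of 0 \<Rightarrow> (if j = 0 then 1 else 0) | Suc k \<Rightarrow> A (idx k) j"
  define b where "b i l = (\<Sum>j\<in>{j. j < C \<and> h j = l}. \<bar>v j\<bar> * ?A i j)" for i l
  have "{..<Suc K} = {..K}" by auto
  then have "tnn (Suc K) C (\<lambda>k j. A (idx k) j)"
    using tnn_submatrix[OF A, of "Suc K" idx C "\<lambda>j. j"] idx by (simp add: strict_mono_on_def)
  then have "tnn C (Suc (Suc K)) (\<lambda>j i. ?A i j)"
    using tnn_transpose[OF tnn_unit_row_on_top] by blast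
  then have "tnn (Suc K) (Suc (Suc K)) (\<lambda>l i. b i l)"
  proof (rule tnn_row_combination)
    show "b j i = (\<Sum>l\<in>{j. j < C \<and> h j = i}. \<bar>v l\<bar> * ?A j l)" for i j
      by (simp add: b_def)
    show "l \<le> l'" if "i < i'" "l \<in> {j. j < C \<and> h j = i}" "l' \<in> {j. j < C \<and> h j = i'}" for i i' l l'
      using that h(1)[of l' l] by (cases "l \<le> l'") auto
  qed auto
  then have b: "tnn (Suc (Suc K)) (Suc K) b" using tnn_transpose by blast
  have bw: "(\<Sum>l<Suc K. b i l * (-1) ^ l) = (\<Sum>j<C. ?A i j * v j)" for i
  proof -
    have "(\<Sum>j<C. ?A i j * v j) = (\<Sum>l\<in>{..<Suc K}. \<Sum>j\<in>{j. j \<in> {..<C} \<and> h j = l}. ?A i j * v j)"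
      using h(2) by (intro sum.group[symmetric]) (auto simp: less_Suc_eq_le)
    also have "\<dots> = (\<Sum>l<Suc K. b i l * (-1) ^ l)"
    proof (intro sum.cong refl)
      fix l
      have "?A i j * v j = \<bar>v j\<bar> * ?A i j * (-1) ^ h j" if "j < C" for j
      proof -
        have "\<bar>v j\<bar> = \<bar>(-1) ^ h j * v j\<bar>" by (simp add: abs_mult)
        also have "\<dots> = (-1) ^ h j * v j" using v(1)[OF that] by simp
        finally have "\<bar>v j\<bar> * (-1) ^ h j = v j"
          by (simp add: mult.commute mult.left_commute power_mult_distrib[symmetric])
        then show ?thesis by (metis mult.assoc mult.commute)
      qed
      then have eq: "?A i j * v j = \<bar>v j\<bar> * ?A i j * (-1) ^ l" if "j \<in> {j. j < C \<and> h j = l}" for j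
        using that by blast
      show "(\<Sum>j\<in>{j. j \<in> {..<C} \<and> h j = l}. ?A i j * v j) = b i l * (-1) ^ l"
        unfolding b_def sum_distrib_right by (rule sum.cong) (simp, rule eq)
    qed
    finally show ?thesis by simp
  qed
  show False
  proof (rule tnn_no_full_alternation[OF b])
    fix k assume k: "k \<le> Suc K"
    show "0 < (-1) ^ k * (\<Sum>l<Suc K. b k l * (-1) ^ l)"
    proof (cases k)
      case 0
      have "(\<Sum>j<C. ?A 0 j * v j) = (\<Sum>j<C. if j = 0 then v j else 0)" by (intro sum.cong) auto
      also have "\<dots> = v 0" using C by (subst sum.delta) auto
      finally show ?thesis using v(2) unfolding bw 0 by simp
    next
      case (Suc k')
      then show ?thesis using neg[of k'] k unfolding bw by simp
    qed
  qed
qed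

section \<open>Uniformly rotating vectors\<close>

lemma cos_minus_pi_half: "cos (x - pi / 2) = sin (x :: real)"
  by (simp add: cos_diff)

lemma sin_sign_between:
  fixes m :: nat
  shows "real m * pi \<le> y \<Longrightarrow> y \<le> (real m + 1) * pi \<Longrightarrow> 0 \<le> (-1) ^ m * sin y"
    and "real m * pi < y \<Longrightarrow> y < (real m + 1) * pi \<Longrightarrow> 0 < (-1) ^ m * sin y"
proof -
  have "sin (y - real m * pi) = (-1) ^ m * sin y"
    by (simp add: sin_diff)
  then show "real m * pi \<le> y \<Longrightarrow> y \<le> (real m + 1) * pi \<Longrightarrow> 0 \<le> (-1) ^ m * sin y"
    and "real m * pi < y \<Longrightarrow> y < (real m + 1) * pi \<Longrightarrow> 0 < (-1) ^ m * sin y"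
    using sin_ge_zero[of "y - real m * pi"] sin_gt_zero[of "y - real m * pi"]
    by (auto simp: algebra_simps)
qed

text \<open>
  If the phase of \<open>cos (X + i \<theta>)\<close> advances slowly, then \<open>(-1)\<^sup>i cos (X + i \<theta>)\<close> alternates often. Up to a
  common sign, the sign of the latter is \<open>(-1)\<close> to the power \<open>F i\<close>, where \<open>F i\<close> is \<open>i + 1\<close> minus the number of half-turns made so
  far. Since \<open>\<theta> < \<pi>\<close>, \<open>F\<close> rises by at most one in each step, hence takes all the values \<open>0, \<dots>, K\<close>. At the
  first index with \<open>F i \<ge> k\<close> no half-turn has just been completed, so the cosine is not zero there.
\<close>
lemma rotation_alternation:
  fixes X \<theta> :: real and N K :: nat
  assumes \<theta>: "0 < \<theta>" "\<theta> < pi" and X: "pi / 2 < X" and N: "0 < N"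
    and bound: "X + pi / 2 + (real N - 1) * \<theta> < (real N + 1 - real K) * pi"
  obtains idx where "strict_mono_on {..K} idx" "idx ` {..K} \<subseteq> {..<N}"
    "\<And>k. k \<le> K \<Longrightarrow> (-1) ^ k * ((-1) ^ idx k * cos (X + real (idx k) * \<theta>)) < 0"
proof -
  define Y where "Y i = X + pi / 2 + real i * \<theta>" for i
  define G where "G i = \<lfloor>Y i / pi\<rfloor>" for i
  define F where "F i = int i + 1 - G i" for i
  define idx where "idx k = (LEAST i. int k \<le> F i)" for k
  have G: "of_int (G i) * pi \<le> Y i" "Y i < (of_int (G i) + 1) * pi" for i
    unfolding G_def by (simp_all only: floor_divide_lower floor_divide_upper pi_gt_zero)
  have G_mono: "G i \<le> G (Suc i)" for i
    unfolding G_def Y_def using \<theta> by (intro floor_mono divide_right_mono) auto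
  have Y0: "pi < Y 0" using X by (simp add: Y_def)
  have G0: "1 \<le> G 0" unfolding G_def using Y0 by (simp add: le_floor_iff)
  have "Y (N - 1) / pi < of_int (int N + 1 - int K)"
    using bound N by (simp add: Y_def divide_less_eq of_nat_diff)
  then have "G (N - 1) < int N + 1 - int K" unfolding G_def floor_less_iff .
  then have FN: "int K \<le> F (N - 1)" unfolding F_def using N by simp
  have ge: "int k \<le> F (idx k)" and lt: "idx k < N" if "k \<le> K" for k
  proof -
    have *: "int k \<le> F (N - 1)" using FN that by simp
    show "int k \<le> F (idx k)" unfolding idx_def by (rule LeastI[where P="\<lambda>i. int k \<le> F i", OF *])
    have "idx k \<le> N - 1" unfolding idx_def by (rule Least_le[where P="\<lambda>i. int k \<le> F i", OF *])
    then show "idx k < N" using N by simp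
  qed
  have eq: "F (idx k) = int k" if "k \<le> K" for k
  proof (cases "idx k")
    case 0
    then show ?thesis using ge[OF that] G0 by (simp add: F_def)
  next
    case (Suc i)
    then have "\<not> int k \<le> F i" using not_less_Least[of i "\<lambda>i. int k \<le> F i"] by (simp add: idx_def)
    then show ?thesis using ge[OF that] G_mono[of i] Suc by (simp add: F_def)
  qed
  have mono: "idx k < idx k'" if "k < k'" "k' \<le> K" for k k'
  proof -
    have "idx k \<le> idx k'" unfolding idx_def[of k] using eq[of k'] that by (intro Least_le) simp
    moreover have "idx k \<noteq> idx k'" using eq[of k] eq[of k'] that by auto
    ultimately show ?thesis by simp
  qed
  have sgn: "(-1) ^ k * ((-1) ^ idx k * cos (X + real (idx k) * \<theta>)) < 0" if k: "k \<le> K" for k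
  proof -
    define i where "i = idx k"
    have Gi: "G i = int i + 1 - int k" using eq[OF k] by (simp add: F_def i_def)
    have strict: "of_int (G i) * pi < Y i"
    proof (cases i)
      case 0
      then have "G i \<le> 1" using Gi by simp
      then have "of_int (G i) * pi \<le> 1 * pi" by (intro mult_right_mono) auto
      also have "\<dots> < Y i" using Y0 0 by simp
      finally show ?thesis .
    next
      case (Suc i')
      then have "\<not> int k \<le> F i'" using not_less_Least[of i' "\<lambda>i. int k \<le> F i"] by (simp add: i_def idx_def)
      then have "G i \<le> G i'" using Gi Suc by (simp add: F_def)
      then have "of_int (G i) * pi \<le> of_int (G i') * pi" by (intro mult_right_mono) auto
      also have "\<dots> \<le> Y i'" by (rule G(1))
      also have "\<dots> < Y i" using \<theta> Suc by (simp add: Y_def)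
      finally show ?thesis .
    qed
    have "G 0 \<le> G i" by (induction i) (use G_mono order_trans in blast)+
    then have "0 \<le> G i" using G0 by simp
    then obtain m where m: "G i = int m" using nonneg_int_cases by blast
    have "0 < (-1) ^ m * sin (Y i)"
      using strict G(2)[of i] by (intro sin_sign_between(2)) (simp_all add: m)
    moreover have "sin (Y i) = cos (X + real i * \<theta>)"
      using cos_minus_pi_half[of "Y i"] by (simp add: Y_def)
    moreover have "i + 1 = k + m" using Gi m by simp
    then have "(-1) ^ k * (-1) ^ m = (-1 :: real) ^ (i + 1)" by (metis power_add)
    then have "(-1) ^ k * (-1) ^ i = - ((-1 :: real) ^ m)"
      by (cases "even k"; cases "even m"; cases "even i") auto
    ultimately show ?thesis by (simp add: i_def[symmetric] mult.assoc[symmetric])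
  qed
  show thesis
    by (rule that[of idx]) (use mono lt sgn in \<open>auto intro!: strict_mono_onI\<close>)
qed

lemma rotation_blocks:
  fixes V \<theta> :: real
  assumes "0 < \<theta>" "- (pi / 2) \<le> V" "V + pi / 2 + 2 * (real n - 1) * \<theta> < (real K + 1) * pi"
  obtains h :: "nat \<Rightarrow> nat" where "mono h" "\<And>j. j < n \<Longrightarrow> h j \<le> K"
    "\<And>j. 0 \<le> (-1) ^ h j * cos (V + 2 * real j * \<theta>)"
proof -
  define Y where "Y j = V + pi / 2 + 2 * real j * \<theta>" for j
  define h where "h j = nat \<lfloor>Y j / pi\<rfloor>" for j
  have Y0: "0 \<le> Y j" for j using assms by (simp add: Y_def)
  have Ymono: "Y j \<le> Y j'" if "j \<le> j'" for j j' using assms that by (simp add: Y_def mult_right_mono)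
  show thesis
  proof (rule that[of h])
    show "mono h" unfolding h_def
      by (intro monoI nat_mono floor_mono divide_right_mono Ymono) auto
    show "h j \<le> K" if "j < n" for j
    proof -
      have "real j \<le> real n - 1" using that by simp
      then have "2 * real j * \<theta> \<le> 2 * (real n - 1) * \<theta>" using assms(1) by (intro mult_right_mono) auto
      then have "Y j / pi < of_int (int K + 1)" using assms(3) by (simp add: Y_def divide_less_eq)
      then have "\<lfloor>Y j / pi\<rfloor> < int K + 1" unfolding floor_less_iff .
      then show ?thesis by (simp add: h_def)
    qed
    show "0 \<le> (-1) ^ h j * cos (V + 2 * real j * \<theta>)" for j
    proof -
      have "real (h j) = of_int \<lfloor>Y j / pi\<rfloor>" using Y0[of j] by (simp add: h_def)
      then have "real (h j) * pi \<le> Y j" "Y j \<le> (real (h j) + 1) * pi"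
        using floor_divide_lower[of pi "Y j"] floor_divide_upper[of pi "Y j"] by simp_all
      then have "0 \<le> (-1) ^ h j * sin (Y j)" by (rule sin_sign_between)
      moreover have "sin (Y j) = cos (V + 2 * real j * \<theta>)"
        using cos_minus_pi_half[of "Y j"] by (simp add: Y_def)
      ultimately show ?thesis by simp
    qed
  qed
qed

text \<open>
  The initial phase \<open>V\<close> makes \<open>v\<close> start with a positive entry, and \<open>X > \<pi>/2\<close> makes the alternation of the image
  start, at the latest after a first half-turn, with a negative one. The two bounds say that \<open>v\<close> has at
  most \<open>K\<close> sign changes and that its image has at least that many.
\<close>
lemma tnn_no_slow_rotation_at_phases:
  fixes \<rho> \<theta> V X :: real
  assumes A: "tnn n n A" and n: "0 < n" and \<rho>: "0 < \<rho>" and \<theta>: "0 < \<theta>" "\<theta> < pi" and d: "0 < d"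
    and V: "- (pi / 2) < V" "V < pi / 2" "V + pi / 2 + 2 * (real n - 1) * \<theta> < (real K + 1) * pi"
    and X: "pi / 2 < X" "X + pi / 2 + (real n - 1) * \<theta> < (real n + 1 - real K) * pi"
    and rel: "\<And>i. i < n \<Longrightarrow> (\<Sum>j<n. A i j * (\<rho> ^ (2 * j + 1) * cos (V + 2 * real j * \<theta>)))
       = (-1) ^ i * (d * \<rho> ^ i * cos (X + real i * \<theta>))"
  shows False
proof -
  obtain idx where idx: "strict_mono_on {..K} idx" "idx ` {..K} \<subseteq> {..<n}"
    "\<And>k. k \<le> K \<Longrightarrow> (-1) ^ k * ((-1) ^ idx k * cos (X + real (idx k) * \<theta>)) < 0"
    using rotation_alternation[OF \<theta> X(1) n X(2)] by blast
  obtain h :: "nat \<Rightarrow> nat" where h: "mono h" "\<And>j. j < n \<Longrightarrow> h j \<le> K"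
    "\<And>j. 0 \<le> (-1) ^ h j * cos (V + 2 * real j * \<theta>)"
    using rotation_blocks[OF \<theta>(1) _ V(3)] V(1) by (metis less_imp_le)
  show False
  proof (rule tnn_variation_diminishing[OF A n, of h K "\<lambda>j. \<rho> ^ (2 * j + 1) * cos (V + 2 * real j * \<theta>)" idx])
    show "h j \<le> h j'" if "j \<le> j'" for j j' using h(1) that by (rule monoD)
    show "0 \<le> (-1) ^ h j * (\<rho> ^ (2 * j + 1) * cos (V + 2 * real j * \<theta>))" for j
    proof -
      have "0 \<le> \<rho> ^ (2 * j + 1) * ((-1) ^ h j * cos (V + 2 * real j * \<theta>))"
        by (rule mult_nonneg_nonneg) (use h(3)[of j] \<rho> in auto)
      then show ?thesis by (simp add: algebra_simps)
    qed
    show "0 < \<rho> ^ (2 * 0 + 1) * cos (V + 2 * real 0 * \<theta>)"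
      using \<rho> cos_gt_zero_pi[of V] V by simp
    show "(-1) ^ k * (\<Sum>j<n. A (idx k) j * (\<rho> ^ (2 * j + 1) * cos (V + 2 * real j * \<theta>))) < 0"
      if "k \<le> K" for k
    proof -
      have "idx k < n" using idx(2) that by auto
      moreover have "(d * \<rho> ^ idx k) * ((-1) ^ k * ((-1) ^ idx k * cos (X + real (idx k) * \<theta>))) < 0"
        by (rule mult_pos_neg) (use idx(3)[OF that] d \<rho> in auto)
      ultimately show ?thesis by (simp only: rel) (simp add: algebra_simps)
    qed
  qed (use h idx in auto)
qed

text \<open>
  The phase difference \<open>\<psi>\<close> of the two rotating vectors is given, but their common initial phase is free.
  Letting \<open>v\<close> start just after a zero crossing saves one of its sign changes; letting the image
  start just after a zero crossing gains one for the image. The first choice succeeds for \<open>\<psi> \<ge> \<pi>\<close> and the second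
  one for \<open>\<psi> < \<pi>\<close>; in both cases the initial phase of the image exceeds \<open>\<pi>/2\<close>.
\<close>
lemma tnn_no_slow_rotation:
  fixes \<rho> \<theta> \<psi> :: real
  assumes A: "tnn n n A" and n: "0 < n" and \<rho>: "0 < \<rho>" and \<theta>: "0 < \<theta>" "\<theta> < pi" and d: "0 < d"
    and \<psi>: "0 < \<psi>" "\<psi> \<le> 2 * pi"
    and slow: "2 * (real n - 1) * \<theta> < (real K + 1) * pi" "(real n - 1) * \<theta> < (real n - 1 - real K) * pi"
    and rel: "\<And>V i. i < n \<Longrightarrow> (\<Sum>j<n. A i j * (\<rho> ^ (2 * j + 1) * cos (V + 2 * real j * \<theta>)))
       = (-1) ^ i * (d * \<rho> ^ i * cos (V + \<psi> + real i * \<theta>))"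
  shows False
proof -
  define M where "M = Min {pi, \<psi>, (real K + 1) * pi - 2 * (real n - 1) * \<theta>,
     (real n - 1 - real K) * pi - (real n - 1) * \<theta>}"
  have "0 < M" unfolding M_def using \<psi> slow by simp
  moreover have "M \<le> pi" "M \<le> \<psi>" "M \<le> (real K + 1) * pi - 2 * (real n - 1) * \<theta>"
    "M \<le> (real n - 1 - real K) * pi - (real n - 1) * \<theta>" unfolding M_def by simp_all
  moreover define \<eta> where "\<eta> = M / 2"
  ultimately have \<eta>: "0 < \<eta>" "\<eta> < pi" "\<eta> < \<psi>" "\<eta> < (real K + 1) * pi - 2 * (real n - 1) * \<theta>"
    "\<eta> < (real n - 1 - real K) * pi - (real n - 1) * \<theta>"
    by linarith+
  show False
  proof (cases "pi \<le> \<psi>")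
    case True
    have "\<eta> - pi / 2 + \<psi> + pi / 2 + (real n - 1) * \<theta> < (real n + 1 - real K) * pi"
      using \<eta>(5) \<psi>(2) by (simp add: algebra_simps)
    moreover have "\<eta> - pi / 2 + pi / 2 + 2 * (real n - 1) * \<theta> < (real K + 1) * pi"
      using \<eta>(4) by linarith
    ultimately show ?thesis
      using True \<eta>(1,2)
      by (intro tnn_no_slow_rotation_at_phases[OF A n \<rho> \<theta> d _ _ _ _ _ rel, of "\<eta> - pi / 2" K])
        linarith+
  next
    case False
    have "\<eta> + pi / 2 - \<psi> + \<psi> + pi / 2 + (real n - 1) * \<theta> < (real n + 1 - real (Suc K)) * pi"
      using \<eta>(5) by (simp add: algebra_simps)
    moreover have "\<eta> + pi / 2 - \<psi> + pi / 2 + 2 * (real n - 1) * \<theta> < (real (Suc K) + 1) * pi"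
      using \<eta>(3,4) \<psi>(1) by (simp add: algebra_simps)
    ultimately show ?thesis
      using False \<eta>(1,2,3)
      by (intro tnn_no_slow_rotation_at_phases[OF A n \<rho> \<theta> d _ _ _ _ _ rel, of "\<eta> + pi / 2 - \<psi>" "Suc K"])
        linarith+
  qed
qed

text \<open>
  The entries \<open>B t (c + t)\<close> are the last nonzero ones of their rows, so forward substitution works.
\<close>
lemma echelon_system_solvable:
  fixes B :: "nat \<Rightarrow> nat \<Rightarrow> real"
  assumes "\<And>t. t < T \<Longrightarrow> c + t < n" "\<And>t. t < T \<Longrightarrow> B t (c + t) \<noteq> 0"
    "\<And>t j. t < T \<Longrightarrow> c + t < j \<Longrightarrow> j < n \<Longrightarrow> B t j = 0"
  shows "\<exists>x. \<forall>t<T. (\<Sum>j<n. B t j * x j) = r t"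
  using assms
proof (induction T)
  case 0
  then show ?case by simp
next
  case (Suc T)
  have "\<exists>x. \<forall>t<T. (\<Sum>j<n. B t j * x j) = r t"
    by (rule Suc.IH) (use Suc.prems in \<open>simp_all add: less_SucI\<close>)
  then obtain x where x: "\<And>t. t < T \<Longrightarrow> (\<Sum>j<n. B t j * x j) = r t" by blast
  define \<delta> where "\<delta> = (r T - (\<Sum>j<n. B T j * x j)) / B T (c + T)"
  let ?x = "\<lambda>j. x j + (if j = c + T then \<delta> else 0)"
  have cT: "c + T < n" "B T (c + T) \<noteq> 0" using Suc.prems by auto
  have upd: "(\<Sum>j<n. B t j * ?x j) = (\<Sum>j<n. B t j * x j) + B t (c + T) * \<delta>" for t
  proof -
    have "(\<Sum>j<n. B t j * ?x j) = (\<Sum>j<n. B t j * x j) + (\<Sum>j<n. if j = c + T then B t j * \<delta> else 0)"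
      unfolding sum.distrib[symmetric] by (intro sum.cong) (auto simp: distrib_left)
    then show ?thesis using cT by simp
  qed
  have "(\<Sum>j<n. B t j * ?x j) = r t" if "t < Suc T" for t
  proof (cases "t = T")
    case True
    then show ?thesis unfolding upd using cT by (simp add: \<delta>_def)
  next
    case False
    then have "t < T" using that by simp
    moreover from this have "B t (c + T) = 0" using Suc.prems(3)[of t "c + T"] cT by simp
    ultimately show ?thesis unfolding upd using x by simp
  qed
  then show ?case by (intro exI[of _ ?x] allI impI)
qed

text \<open>
  A kernel vector has no image whose signs could be counted. But if \<open>v\<close> has no zero entry, a small multiple
  of a solution \<open>x\<close> of \<open>(A x)\<^bsub>idx t\<^esub> = -(-1)\<^sup>t\<close> can be added to it without altering its signs, and the image of
  the sum alternates \<open>K\<close> times and begins with the wrong sign.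
\<close>
lemma tnn_no_slow_rotation_in_kernel:
  fixes \<rho> \<theta> :: real
  assumes A: "tnn n n A" and n: "0 < n" and \<rho>: "0 < \<rho>" and \<theta>: "0 < \<theta>"
    and slow: "2 * (real n - 1) * \<theta> < (real K + 1) * pi"
    and idx: "strict_mono_on {..K} idx" "idx ` {..K} \<subseteq> {..<n}"
    and ech: "c + K < n" "\<And>t. t \<le> K \<Longrightarrow> A (idx t) (c + t) \<noteq> 0"
      "\<And>t j. t \<le> K \<Longrightarrow> c + t < j \<Longrightarrow> j < n \<Longrightarrow> A (idx t) j = 0"
    and rel: "\<And>V t. t \<le> K \<Longrightarrow> (\<Sum>j<n. A (idx t) j * (\<rho> ^ (2 * j + 1) * cos (V + 2 * real j * \<theta>))) = 0"
  shows False
proof -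
  define v where "v \<eta> j = \<rho> ^ (2 * j + 1) * cos (\<eta> - pi / 2 + 2 * real j * \<theta>)" for \<eta> :: real and j :: nat
  have v_sin: "v \<eta> j = \<rho> ^ (2 * j + 1) * sin (\<eta> + 2 * real j * \<theta>)" for \<eta> j
  proof -
    have "cos (\<eta> - pi / 2 + 2 * real j * \<theta>) = sin (\<eta> + 2 * real j * \<theta>)"
      using cos_minus_pi_half[of "\<eta> + 2 * real j * \<theta>"] by (simp add: add_diff_eq diff_add_eq)
    then show ?thesis by (simp add: v_def)
  qed
  define b where "b = min pi ((real K + 1) * pi - 2 * (real n - 1) * \<theta>)"
  have b: "0 < b" using slow by (simp add: b_def)
  \<comment> \<open>Each entry vanishes for at most one offset \<open>\<eta>\<close> in an open interval of length at most \<open>\<pi>\<close>.\<close>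
  have fin: "finite {\<eta> \<in> {0<..<b}. \<exists>j\<in>{..<n}. v \<eta> j = 0}"
  proof -
    have "finite {\<eta> \<in> {0<..<b}. v \<eta> j = 0}" for j
    proof (cases "{\<eta> \<in> {0<..<b}. v \<eta> j = 0} = {}")
      case False
      then obtain \<eta>0 where 0: "0 < \<eta>0" "\<eta>0 < b" "v \<eta>0 j = 0" by auto
      have "\<eta> = \<eta>0" if "0 < \<eta>" "\<eta> < b" "v \<eta> j = 0" for \<eta>
      proof -
        have s: "sin (\<eta> + 2 * real j * \<theta>) = 0" "sin (\<eta>0 + 2 * real j * \<theta>) = 0"
          using that 0 \<rho> by (simp_all add: v_sin)
        have "sin ((\<eta> + 2 * real j * \<theta>) - (\<eta>0 + 2 * real j * \<theta>)) = 0"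
          unfolding sin_diff s by simp
        then have "sin (\<eta> - \<eta>0) = 0" by simp
        moreover have "\<bar>\<eta> - \<eta>0\<bar> < pi" using that 0 by (auto simp: b_def)
        ultimately show ?thesis using sin_eq_0_pi[of "\<eta> - \<eta>0"] by auto
      qed
      then have "{\<eta> \<in> {0<..<b}. v \<eta> j = 0} \<subseteq> {\<eta>0}" by auto
      then show ?thesis by (rule finite_subset) simp
    qed (simp only: finite.emptyI)
    then have "finite (\<Union>j\<in>{..<n}. {\<eta> \<in> {0<..<b}. v \<eta> j = 0})" by simp
    then show ?thesis by (rule rev_finite_subset) auto
  qed
  have "infinite {0<..<b}" using b by (simp add: infinite_Ioo)
  then have "infinite ({0<..<b} - {\<eta> \<in> {0<..<b}. \<exists>j\<in>{..<n}. v \<eta> j = 0})"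
    using fin by (rule Diff_infinite_finite[rotated])
  then have "{0<..<b} - {\<eta> \<in> {0<..<b}. \<exists>j\<in>{..<n}. v \<eta> j = 0} \<noteq> {}" by (rule infinite_imp_nonempty)
  then obtain \<eta> where "\<eta> \<in> {0<..<b}" "\<not> (\<exists>j\<in>{..<n}. v \<eta> j = 0)" by blast
  then have \<eta>: "0 < \<eta>" "\<eta> < b" and nz: "\<And>j. j < n \<Longrightarrow> v \<eta> j \<noteq> 0" by auto
  have range: "- (pi / 2) \<le> \<eta> - pi / 2"
      "\<eta> - pi / 2 + pi / 2 + 2 * (real n - 1) * \<theta> < (real K + 1) * pi"
    using \<eta> unfolding b_def by linarith+
  obtain h :: "nat \<Rightarrow> nat" where h: "mono h" "\<And>j. j < n \<Longrightarrow> h j \<le> K"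
    "\<And>j. 0 \<le> (-1) ^ h j * cos (\<eta> - pi / 2 + 2 * real j * \<theta>)"
    using rotation_blocks[OF \<theta> range] by blast
  have hv: "0 \<le> (-1) ^ h j * v \<eta> j" for j
  proof -
    have "0 \<le> \<rho> ^ (2 * j + 1) * ((-1) ^ h j * cos (\<eta> - pi / 2 + 2 * real j * \<theta>))"
      by (rule mult_nonneg_nonneg) (use h(3)[of j] \<rho> in auto)
    then show ?thesis by (simp add: v_def algebra_simps)
  qed
  obtain x where x: "\<And>t. t < Suc K \<Longrightarrow> (\<Sum>j<n. A (idx t) j * x j) = - ((-1) ^ t)"
    using echelon_system_solvable[of "Suc K" c n "\<lambda>t. A (idx t)" "\<lambda>t. - ((-1) ^ t)"] ech by auto
  define \<epsilon> where "\<epsilon> = Min ((\<lambda>j. \<bar>v \<eta> j\<bar> / (1 + \<bar>x j\<bar>)) ` {..<n})"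
  have "0 < \<epsilon>" unfolding \<epsilon>_def using n nz by (subst Min_gr_iff) (auto intro!: divide_pos_pos)
  have small: "\<bar>\<epsilon> * x j\<bar> < \<bar>v \<eta> j\<bar>" if "j < n" for j
  proof -
    have "\<epsilon> \<le> \<bar>v \<eta> j\<bar> / (1 + \<bar>x j\<bar>)" unfolding \<epsilon>_def using that by (intro Min_le) auto
    then have "\<epsilon> * (1 + \<bar>x j\<bar>) \<le> \<bar>v \<eta> j\<bar>" by (simp add: field_simps)
    then show ?thesis using \<open>0 < \<epsilon>\<close> by (simp add: abs_mult distrib_left)
  qed
  show False
  proof (rule tnn_variation_diminishing[OF A n, of h K "\<lambda>j. v \<eta> j + \<epsilon> * x j" idx])
    show "h j \<le> h j'" if "j \<le> j'" for j j' using h(1) that by (rule monoD)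
    show "0 \<le> (-1) ^ h j * (v \<eta> j + \<epsilon> * x j)" if "j < n" for j
      using hv[of j] small[OF that] by (cases "even (h j)") auto
    have "0 < v \<eta> 0" using \<eta> \<rho> by (simp add: v_sin b_def sin_gt_zero)
    then show "0 < v \<eta> 0 + \<epsilon> * x 0" using small[OF n] by linarith
    show "(-1) ^ k * (\<Sum>j<n. A (idx k) j * (v \<eta> j + \<epsilon> * x j)) < 0" if "k \<le> K" for k
    proof -
      have "(\<Sum>j<n. A (idx k) j * (v \<eta> j + \<epsilon> * x j)) =
          (\<Sum>j<n. A (idx k) j * v \<eta> j) + \<epsilon> * (\<Sum>j<n. A (idx k) j * x j)"
        by (simp add: distrib_left sum.distrib sum_distrib_left mult.left_commute)
      also have "\<dots> = - \<epsilon> * (-1) ^ k"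
        using rel[OF that, of "\<eta> - pi / 2"] x[of k] that by (simp add: v_def)
      finally show ?thesis using \<open>0 < \<epsilon>\<close> by (cases "even k") auto
    qed
  qed (use h idx in auto)
qed

section \<open>The zero-free sector\<close>

lemma desc_coeff_nat: "desc_coeff p (int k) = (if k \<le> degree p then coeff p (degree p - k) else 0)"
  by (simp add: desc_coeff_def)

lemma tnn_hurwitz_iff:
  "totally_nonneg (hurwitz_mat p) \<longleftrightarrow>
     tnn (degree p) (degree p) (\<lambda>i j. desc_coeff p (2 * int j + 1 - int i))"
  unfolding hurwitz_mat_def totally_nonneg_mat_iff by (simp add: algebra_simps)

lemma poly_complex_descending:
  fixes z :: complex
  assumes "z \<noteq> 0"
  shows "poly (map_poly complex_of_real p) z =
    z ^ degree p * (\<Sum>k\<le>degree p. desc_coeff p (int k) * inverse z ^ k)"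
proof -
  let ?n = "degree p"
  have "poly (map_poly complex_of_real p) z = (\<Sum>i\<le>?n. complex_of_real (coeff p i) * z ^ i)"
    by (simp add: poly_altdef coeff_map_poly degree_map_poly)
  also have "\<dots> = (\<Sum>k\<le>?n. complex_of_real (coeff p (?n - k)) * z ^ (?n - k))"
    by (rule sum.reindex_bij_witness[of _ "\<lambda>k. ?n - k" "\<lambda>k. ?n - k"]) auto
  also have "\<dots> = (\<Sum>k\<le>?n. z ^ ?n * (desc_coeff p (int k) * inverse z ^ k))"
    using assms by (intro sum.cong) (auto simp: desc_coeff_nat power_diff field_simps)
  finally show ?thesis by (simp add: sum_distrib_left)
qed

text \<open>
  Row \<open>i\<close> lists the coefficients whose index has the parity of \<open>i + 1\<close> (rows being counted from \<open>0\<close>). All of these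
  coefficients occur, so the row evaluates half of the reversed polynomial completely.
\<close>
lemma hurwitz_row_apply:
  fixes y :: complex
  assumes i: "i < degree p"
  shows "(\<Sum>j<degree p. desc_coeff p (2 * int j + 1 - int i) * y ^ (2 * j + 1)) =
    y ^ i * (\<Sum>k | k \<le> degree p \<and> odd (k + i). desc_coeff p (int k) * y ^ k)"
proof -
  let ?n = "degree p"
  let ?t = "\<lambda>j. desc_coeff p (2 * int j + 1 - int i) * y ^ (2 * j + 1)"
  let ?J = "{j. j < ?n \<and> i \<le> 2 * j + 1 \<and> 2 * j + 1 \<le> ?n + i}"
  have "(\<Sum>j<?n. ?t j) = (\<Sum>j\<in>?J. ?t j)"
  proof (intro sum.mono_neutral_right ballI)
    fix j assume "j \<in> {..<?n} - ?J"
    then have "2 * int j + 1 - int i < 0 \<or> int ?n < 2 * int j + 1 - int i" by auto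
    then show "?t j = 0" by (auto simp: desc_coeff_def)
  qed auto
  also have "\<dots> = (\<Sum>k | k \<le> ?n \<and> odd (k + i). y ^ i * (desc_coeff p (int k) * y ^ k))"
  proof (rule sum.reindex_bij_witness[where i = "\<lambda>k. (k + i - 1) div 2" and j = "\<lambda>j. 2 * j + 1 - i"])
    fix k assume k: "k \<in> {k. k \<le> ?n \<and> odd (k + i)}"
    then have e: "even (k + i - 1)" "1 \<le> k + i" by (auto elim!: oddE)
    then have d: "2 * ((k + i - 1) div 2) + 1 = k + i" by auto
    show "2 * ((k + i - 1) div 2) + 1 - i = k" using d by simp
    show "(k + i - 1) div 2 \<in> ?J" using d k i by auto
  next
    fix j assume "j \<in> ?J"
    then have le: "i \<le> 2 * j + 1" "2 * j + 1 \<le> ?n + i" by auto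
    then show "(2 * j + 1 - i + i - 1) div 2 = j" by simp
    have "2 * j + 1 - i + i = 2 * j + 1" using le by simp
    then have "odd (2 * j + 1 - i + i)" by simp
    then show "2 * j + 1 - i \<in> {k. k \<le> ?n \<and> odd (k + i)}" using le by simp
    have "int (2 * j + 1 - i) = 2 * int j + 1 - int i" using le by (simp add: of_nat_diff)
    moreover have "y ^ (2 * j + 1) = y ^ i * y ^ (2 * j + 1 - i)"
      using le by (simp only: power_add[symmetric] le_add_diff_inverse)
    ultimately show "y ^ i * (desc_coeff p (int (2 * j + 1 - i)) * y ^ (2 * j + 1 - i)) = ?t j"
      by simp
  qed
  finally show ?thesis by (simp add: sum_distrib_left)
qed

text \<open>
  Here \<open>K = (n-1) div 2\<close> turns both cases of the definition of the angle into
  \<open>2 (n-1) \<alpha>\<^sub>n = (K+1) \<pi>\<close>. The second bound needed for \<open>tnn_no_slow_rotation\<close> follows from the first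
  one since \<open>3 (K + 1) \<le> 2 n\<close>. A positive zero is excluded by the nonnegativity of all coefficients.
\<close>
lemma hurwitz_no_root_in_sector:
  fixes y :: complex
  assumes n: "degree p = n" "2 \<le> n" and lead: "desc_coeff p 0 > 0" and const: "desc_coeff p (int n) > 0"
    and tnn: "tnn n n (\<lambda>i j. desc_coeff p (2 * int j + 1 - int i))"
    and y: "y = rcis \<rho> \<theta>" "0 < \<rho>" and \<theta>: "0 \<le> \<theta>" "\<theta> < sector_angle n"
    and root: "(\<Sum>k\<le>n. desc_coeff p (int k) * y ^ k) = 0"
  shows False
proof -
  define H where "H i j = desc_coeff p (2 * int j + 1 - int i)" for i j :: nat
  define Od where "Od = (\<Sum>k | k \<le> n \<and> odd k. desc_coeff p (int k) * y ^ k)"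
  define K where "K = (n - 1) div 2"
  have tnn': "tnn n n H" using tnn unfolding H_def .
  have n0: "0 < n" using n by simp
  have K: "real K = (if odd n then (real n - 1) / 2 else (real n - 2) / 2)"
  proof (cases "odd n")
    case False
    then obtain m where "n = 2 * m" by blast
    moreover from this have "K = m - 1" "1 \<le> m" unfolding K_def using n by auto
    ultimately show ?thesis by (simp add: of_nat_diff)
  qed (auto elim!: oddE simp: K_def)
  have \<theta>K: "2 * (real n - 1) * \<theta> < (real K + 1) * pi"
  proof -
    have "2 * (real n - 1) * sector_angle n = (real K + 1) * pi"
      using n unfolding sector_angle_def K by (auto simp: field_simps)
    moreover have "2 * (real n - 1) * \<theta> < 2 * (real n - 1) * sector_angle n"
      using \<theta> n by (intro mult_strict_left_mono) auto
    ultimately show ?thesis by simp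
  qed
  have K3: "3 * (real K + 1) \<le> 2 * real n" 
    using n by (auto simp: K field_simps elim!: oddE)
  have slow2: "(real n - 1) * \<theta> < (real n - 1 - real K) * pi"
  proof -
    have "(real n - 1) * \<theta> < (real K + 1) / 2 * pi" using \<theta>K by (simp add: field_simps)
    also have "\<dots> \<le> (real n - 1 - real K) * pi" using K3 by (intro mult_right_mono) auto
    finally show ?thesis .
  qed
  have "K + 2 \<le> n" unfolding K_def using n by presburger
  then have "real K + 1 \<le> real n - 1" by simp
  then have "(real K + 1) * pi \<le> (real n - 1) * pi" by (intro mult_right_mono) auto
  moreover have "(real n - 1) * (2 * \<theta>) = 2 * (real n - 1) * \<theta>" by simp
  ultimately have "(real n - 1) * (2 * \<theta>) < (real n - 1) * pi" using \<theta>K by linarith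
  then have "2 * \<theta> < pi" using n by (simp add: mult_less_cancel_left)
  then have \<theta>pi: "\<theta> < pi" using \<theta>(1) by simp
  have row: "(\<Sum>j<n. H i j * y ^ (2 * j + 1)) = (-1) ^ i * Od * y ^ i" if i: "i < n" for i
  proof (cases "even i")
    case True
    then show ?thesis using hurwitz_row_apply[of i p y] i n by (simp add: H_def Od_def)
  next
    case False
    let ?f = "\<lambda>k. complex_of_real (desc_coeff p (int k)) * y ^ k"
    have "sum ?f {k. k \<le> n \<and> even k} + Od = sum ?f ({k. k \<le> n \<and> even k} \<union> {k. k \<le> n \<and> odd k})"
      unfolding Od_def by (intro sum.union_disjoint[symmetric]) auto
    also have "{k. k \<le> n \<and> even k} \<union> {k. k \<le> n \<and> odd k} = {..n}" by auto
    finally have "sum ?f {k. k \<le> n \<and> even k} = - Od" using root by (simp add: eq_neg_iff_add_eq_0)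
    then show ?thesis using False hurwitz_row_apply[of i p y] i n by (simp add: H_def)
  qed
  define \<omega> where "\<omega> = Arg Od"
  have Od: "Od = rcis (cmod Od) \<omega>" by (simp add: \<omega>_def rcis_cmod_Arg)
  have rel: "(\<Sum>j<n. H i j * (\<rho> ^ (2 * j + 1) * cos (V + 2 * real j * \<theta>)))
      = (-1) ^ i * (cmod Od * \<rho> ^ i * cos (V + (\<omega> - \<theta>) + real i * \<theta>))" if i: "i < n" for V i
  proof -
    have "Re (cis (V - \<theta>) * (\<Sum>j<n. H i j * y ^ (2 * j + 1)))
       = (\<Sum>j<n. H i j * Re (cis (V - \<theta>) * y ^ (2 * j + 1)))"
      by (simp add: sum_distrib_left Re_sum mult.left_commute[of "cis _"])
    also have "\<dots> = (\<Sum>j<n. H i j * (\<rho> ^ (2 * j + 1) * cos (V + 2 * real j * \<theta>)))"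
    proof (intro sum.cong refl)
      fix j
      have "cis (V - \<theta>) * y ^ (2 * j + 1) = rcis 1 (V - \<theta>) * rcis (\<rho> ^ (2 * j + 1)) (real (2 * j + 1) * \<theta>)"
        by (simp only: y(1) DeMoivre2 cis_rcis_eq)
      also have "\<dots> = rcis (\<rho> ^ (2 * j + 1)) (V + 2 * real j * \<theta>)"
        unfolding rcis_mult by (simp add: algebra_simps)
      finally show "H i j * Re (cis (V - \<theta>) * y ^ (2 * j + 1)) = H i j * (\<rho> ^ (2 * j + 1) * cos (V + 2 * real j * \<theta>))"
        by simp
    qed
    finally have l: "(\<Sum>j<n. H i j * (\<rho> ^ (2 * j + 1) * cos (V + 2 * real j * \<theta>))) =
       Re (cis (V - \<theta>) * (\<Sum>j<n. H i j * y ^ (2 * j + 1)))" by simp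
    have "cis (V - \<theta>) * (Od * y ^ i) = rcis 1 (V - \<theta>) * (rcis (cmod Od) \<omega> * rcis (\<rho> ^ i) (real i * \<theta>))"
      by (simp only: y(1) DeMoivre2 cis_rcis_eq Od[symmetric])
    also have "\<dots> = rcis (cmod Od * \<rho> ^ i) (V + (\<omega> - \<theta>) + real i * \<theta>)"
      unfolding rcis_mult by (simp add: algebra_simps)
    finally have r: "Re (cis (V - \<theta>) * (Od * y ^ i)) = cmod Od * \<rho> ^ i * cos (V + (\<omega> - \<theta>) + real i * \<theta>)"
      by simp
    have "Re (cis (V - \<theta>) * ((-1) ^ i * Od * y ^ i)) = (-1) ^ i * Re (cis (V - \<theta>) * (Od * y ^ i))"
      by (cases "even i") (simp_all add: algebra_simps)
    then show ?thesis unfolding l row[OF i] r .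
  qed
  consider "\<theta> = 0" | "0 < \<theta>" "Od \<noteq> 0" | "0 < \<theta>" "Od = 0" using \<theta> by fastforce
  then show False
  proof cases
    case 1
    have coeff_nonneg: "0 \<le> desc_coeff p (int k)" if "k \<le> n" for k
    proof -
      define i where "i = (if odd k then 0 else 1 :: nat)"
      define j where "j = (k + i - 1) div 2"
      have ij: "i < n" "j < n" "2 * int j + 1 - int i = int k"
        using that n by (auto simp: i_def j_def elim!: oddE evenE)
      have "0 \<le> H i j" using tnn_entry_nonneg[OF tnn'] ij by simp
      then show ?thesis using ij by (simp add: H_def)
    qed
    have "y = of_real \<rho>" using y 1 by (simp add: rcis_def)
    then have "complex_of_real (\<Sum>k\<le>n. desc_coeff p (int k) * \<rho> ^ k) = 0" using root by simp
    then have "(\<Sum>k\<le>n. desc_coeff p (int k) * \<rho> ^ k) = 0" by (simp only: of_real_eq_0_iff)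
    moreover have "(\<Sum>k\<le>n. desc_coeff p (int k) * \<rho> ^ k) > 0"
      using lead y(2) coeff_nonneg by (intro sum_pos2[of _ 0]) auto
    ultimately show False by simp
  next
    case 2
    \<comment> \<open>The representative of the phase difference modulo \<open>2 \<pi>\<close> in the interval \<open>(0, 2 \<pi>]\<close>.\<close>
    define \<psi> where "\<psi> = (if 0 < \<omega> - \<theta> then \<omega> - \<theta> else \<omega> - \<theta> + 2 * pi)"
    have \<psi>: "0 < \<psi>" "\<psi> \<le> 2 * pi"
      using Arg_bounded[of Od] 2 \<theta>pi by (auto simp: \<psi>_def \<omega>_def)
    have "cos (V + (\<omega> - \<theta>) + real i * \<theta>) = cos (V + \<psi> + real i * \<theta>)" for V i
    proof -
      have "V + (\<omega> - \<theta> + 2 * pi) + real i * \<theta> = V + (\<omega> - \<theta>) + real i * \<theta> + 2 * pi" by simp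
      then show ?thesis unfolding \<psi>_def by (simp only: cos_periodic if_distrib split: if_split) simp
    qed
    then show False
      using rel by (intro tnn_no_slow_rotation[OF tnn' n0 y(2) 2(1) \<theta>pi _ \<psi> \<theta>K slow2, of "cmod Od"]) (use 2 in \<open>simp_all\<close>)
  next
    case 3
    \<comment> \<open>The rows \<open>2 t + e\<close> are those that contain the coefficients with the parity of \<open>n\<close>.\<close>
    define e where "e = (if even n then 1 else 0 :: nat)"
    define idx where "idx t = 2 * t + e" for t
    have nK: "n = 2 * K + 1 + e" "n div 2 + K < n" "n div 2 = K + e"
      using n by (auto simp: K_def e_def elim!: oddE evenE)
    show False
    proof (rule tnn_no_slow_rotation_in_kernel[OF tnn' n0 y(2) 3(1) \<theta>K, of idx "n div 2"])
      show "strict_mono_on {..K} idx" by (auto simp: idx_def strict_mono_on_def)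
      show "idx ` {..K} \<subseteq> {..<n}" using nK by (auto simp: idx_def)
      show "n div 2 + K < n" by (rule nK)
      show "H (idx t) (n div 2 + t) \<noteq> 0" for t
      proof -
        have "2 * int (n div 2 + t) + 1 - int (idx t) = int n" using nK by (simp add: idx_def)
        then show ?thesis using const by (simp only: H_def)
      qed
      show "H (idx t) j = 0" if "n div 2 + t < j" for t j
      proof -
        have "int n < 2 * int j + 1 - int (idx t)" using nK that by (simp add: idx_def)
        then show ?thesis using n by (simp add: H_def desc_coeff_def)
      qed
      show "(\<Sum>j<n. H (idx t) j * (\<rho> ^ (2 * j + 1) * cos (V + 2 * real j * \<theta>))) = 0" if "t \<le> K" for V t
      proof -
        have "idx t < n" using that nK by (simp add: idx_def)
        then show ?thesis using rel[of "idx t" V] 3 by simp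
      qed
    qed
  qed
qed

lemma sector_root_free:
  fixes z :: complex
  assumes n: "degree p = n" "2 \<le> n" and "desc_coeff p 0 > 0" "desc_coeff p (int n) > 0"
    and tnn: "totally_nonneg (hurwitz_mat p)"
    and z: "poly (map_poly complex_of_real p) z = 0" "z \<noteq> 0" "\<bar>Arg z\<bar> < sector_angle n"
  shows False
proof -
  let ?P = "map_poly complex_of_real p"
  define x where "x = (if 0 \<le> Arg z then cnj z else z)"
  have "poly ?P (cnj z) = cnj (poly ?P z)" by (simp add: poly_altdef coeff_map_poly)
  then have x: "poly ?P x = 0" "x \<noteq> 0" using z by (auto simp: x_def)
  have polar: "z = rcis (cmod z) (Arg z)" by (simp add: rcis_cmod_Arg)
  have "inverse x = rcis (inverse (cmod z)) \<bar>Arg z\<bar>"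
  proof (cases "0 \<le> Arg z")
    case True
    have "cnj z = rcis (cmod z) (- Arg z)" by (subst polar) (simp add: rcis_def cis_cnj)
    then show ?thesis using True by (simp add: x_def rcis_inverse divide_inverse)
  next
    case False
    have "inverse z = rcis (1 / cmod z) (- Arg z)" by (subst polar) (rule rcis_inverse)
    then show ?thesis using False by (simp add: x_def divide_inverse)
  qed
  moreover have "(\<Sum>k\<le>n. desc_coeff p (int k) * inverse x ^ k) = 0"
    using poly_complex_descending[OF x(2), of p] x n by simp
  ultimately show False
    using assms tnn_hurwitz_iff[of p] by (intro hurwitz_no_root_in_sector[of p n "inverse x" "inverse (cmod z)" "\<bar>Arg z\<bar>"]) simp_all
qed

section \<open>Toeplitz matrices of trigonometric binomial coefficients\<close>

lemma tnn_identity: "tnn R C (\<lambda>i j. if i = j then 1 else 0)"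
  unfolding tnn_def
proof (intro allI impI, elim conjE)
  fix s :: nat and f g :: "nat \<Rightarrow> nat"
  assume f: "strict_mono_on {..<s} f" and g: "strict_mono_on {..<s} g"
  let ?D = "\<lambda>a b. if f a = g b then 1 else 0 :: real"
  show "0 \<le> square_det s ?D"
  proof (cases "f ` {..<s} \<subseteq> g ` {..<s}")
    case False
    then obtain a where "a < s" "f a \<notin> g ` {..<s}" by blast
    then have "square_det s ?D = 0" by (intro square_det_zero_row[of a]) auto
    then show ?thesis by simp
  next
    case True
    have "card (f ` {..<s}) = s" "card (g ` {..<s}) = s"
      using f g by (simp_all add: card_image strict_mono_on_imp_inj_on)
    then have fg: "f ` {..<s} = g ` {..<s}" using True by (intro card_subset_eq) auto
    have "f a = g a" if "a < s" for a
      using that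
    proof (induction a rule: less_induct)
      case (less a)
      have "f a \<in> g ` {..<s}" "g a \<in> f ` {..<s}" using less.prems fg by auto
      then obtain b c where b: "b < s" "f a = g b" and c: "c < s" "g a = f c" by auto
      have "\<not> b < a"
      proof
        assume "b < a"
        then have "f b = g b" using less.IH b by simp
        then show False using b \<open>b < a\<close> less.prems strict_mono_onD[OF f, of b a] by simp
      qed
      moreover have "\<not> c < a"
      proof
        assume "c < a"
        then have "f c = g c" using less.IH c by simp
        then show False using c \<open>c < a\<close> less.prems strict_mono_onD[OF g, of c a] by simp
      qed
      ultimately have "g a \<le> f a" "f a \<le> g a"
        using b c less.prems strict_mono_on_leD[OF g, of a b] strict_mono_on_leD[OF f, of a c] by auto
      then show ?case by simp
    qed
    then have "square_det s ?D = square_det s (\<lambda>a b. if a = b then 1 else 0)"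
      using strict_mono_on_imp_inj_on[OF g] by (intro square_det_cong) (auto simp: inj_on_def)
    also have "\<dots> = det (1\<^sub>m s)"
      unfolding square_det_def by (intro arg_cong[where f = det] eq_matI) auto
    finally show ?thesis by simp
  qed
qed

text \<open>
  The functions \<open>sin_fact\<close> and \<open>sin_binom\<close> are the factorial and, up to a factor that does not depend on \<open>k\<close>, the
  binomial coefficient in which each number \<open>l\<close> is replaced by \<open>sin (l \<phi>)\<close>. This is the Gaussian binomial
  coefficient at \<open>q = e\<^bsup>2i\<phi>\<^esup>\<close>, made symmetric.
\<close>
definition sin_fact :: "real \<Rightarrow> nat \<Rightarrow> real" where
  "sin_fact \<phi> k = (\<Prod>l = 1..k. sin (real l * \<phi>))"

definition sin_binom :: "real \<Rightarrow> nat \<Rightarrow> nat \<Rightarrow> real" where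
  "sin_binom \<phi> m k = (if k \<le> m then 1 / (sin_fact \<phi> k * sin_fact \<phi> (m - k)) else 0)"

lemma sin_fact_Suc: "sin_fact \<phi> (Suc k) = sin_fact \<phi> k * sin (real (Suc k) * \<phi>)"
  by (simp add: sin_fact_def)

lemma sin_fact_0 [simp]: "sin_fact \<phi> 0 = 1" by (simp add: sin_fact_def)

lemma sin_multiple_pos:
  assumes "0 < \<phi>" "real N * \<phi> < pi" "1 \<le> l" "l \<le> N"
  shows "0 < sin (real l * \<phi>)"
proof (rule sin_gt_zero)
  show "0 < real l * \<phi>" using assms by simp
  have "real l * \<phi> \<le> real N * \<phi>" using assms by (intro mult_right_mono) auto
  then show "real l * \<phi> < pi" using assms by linarith
qed

lemma sin_fact_pos:
  assumes "0 < \<phi>" "real N * \<phi> < pi" "k \<le> N"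
  shows "0 < sin_fact \<phi> k"
  unfolding sin_fact_def using assms sin_multiple_pos[OF assms(1,2)] by (intro prod_pos) auto

lemma sin_binom_pos:
  assumes "0 < \<phi>" "real N * \<phi> < pi" "k \<le> m" "m \<le> N"
  shows "0 < sin_binom \<phi> m k"
  using assms sin_fact_pos[OF assms(1,2)] by (simp add: sin_binom_def)

lemma sin_binom_absorb:
  assumes \<phi>: "0 < \<phi>" "real N * \<phi> < pi" and m: "Suc m \<le> N"
  shows "sin (real (Suc m - k) * \<phi>) * sin_binom \<phi> (Suc m) k = sin_binom \<phi> m k"
    and "sin (real (Suc k) * \<phi>) * sin_binom \<phi> (Suc m) (Suc k) = sin_binom \<phi> m k"
proof -
  show "sin (real (Suc m - k) * \<phi>) * sin_binom \<phi> (Suc m) k = sin_binom \<phi> m k"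
  proof (cases "k \<le> m")
    case True
    then have "Suc m - k = Suc (m - k)" by simp
    moreover have "sin (real (Suc (m - k)) * \<phi>) > 0" using True m by (intro sin_multiple_pos[OF \<phi>]) auto
    ultimately show ?thesis using True by (simp add: sin_binom_def sin_fact_Suc)
  next
    case False
    then show ?thesis by (auto simp: sin_binom_def)
  qed
  show "sin (real (Suc k) * \<phi>) * sin_binom \<phi> (Suc m) (Suc k) = sin_binom \<phi> m k"
  proof (cases "k \<le> m")
    case True
    then have "sin (real (Suc k) * \<phi>) > 0" using m by (intro sin_multiple_pos[OF \<phi>]) auto
    then show ?thesis using True by (simp add: sin_binom_def sin_fact_Suc)
  qed (simp add: sin_binom_def)
qed

text \<open>
  As functions of \<open>x\<close>, both sides are combinations of \<open>sin x\<close> and \<open>cos x\<close>, and they agree for \<open>x = 0\<close> and \<open>x = b\<close>,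
  which suffices for generic \<open>b\<close>.
  It is a form of Ptolemy's theorem, and it replaces Pascal's rule for the trigonometric coefficients.
\<close>
lemma sin_interpolation:
  "sin (a + c) * sin (b - x) + sin (a + b + c) * sin x = sin b * sin (a + x + c)" for a b c x :: real
proof -
  have 1: "a + c - (b - x) = - (b - (a + x + c))" "a + c + (b - x) = a + b + c - x"
    "a + b + c + x = b + (a + x + c)" by simp_all
  show ?thesis unfolding sin_times_sin 1 cos_minus by (simp add: field_simps)
qed

text \<open>
  Pascal's rule for \<open>q\<close>-binomial coefficients has complex weights. But with \<open>s\<^sub>j = sin (j \<phi> + c)\<close>, which is
  positive for \<open>j \<le> N\<close>, the coefficients \<open>e\<^bsub>m,k\<^esub>\<close> satisfy
  \<open>sin ((m+1) \<phi>) s\<^sub>j e\<^bsub>m+1,j-i\<^esub> = s\<^sub>i e\<^bsub>m,j-i\<^esub> + s\<^bsub>i+m+1\<^esub> e\<^bsub>m,j-i-1\<^esub>\<close>.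
  The factor that depends on the column \<open>j\<close> scales columns, and the right-hand side is a nonnegative combination of
  the rows \<open>i\<close> and \<open>i + 1\<close> of the matrix for \<open>m\<close>. Each step trades one row for one
  further nonzero diagonal; the induction starts from the identity pattern.
\<close>
lemma sin_binom_toeplitz_tnn:
  assumes \<phi>: "0 < \<phi>" and c: "0 < c" "real N * \<phi> + c < pi"
  shows "r + m \<le> Suc N \<Longrightarrow> tnn r (Suc N) (\<lambda>i j. if i \<le> j then sin_binom \<phi> m (j - i) else 0)"
proof (induction m arbitrary: r)
  case 0
  have "(\<lambda>i j. if i \<le> j then sin_binom \<phi> 0 (j - i) else 0) = (\<lambda>i j :: nat. if i = j then 1 else 0 :: real)"
    by (auto simp: sin_binom_def fun_eq_iff)
  then show ?case using tnn_identity[of r "Suc N"] by simp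
next
  case (Suc m)
  have N\<phi>: "real N * \<phi> < pi" using c by simp
  define s where "s j = sin (real j * \<phi> + c)" for j :: nat
  have s_pos: "0 < s j" if "j \<le> N" for j
    unfolding s_def
  proof (rule sin_gt_zero)
    show "0 < real j * \<phi> + c" using \<phi> c by (simp add: add_nonneg_pos)
    have "real j * \<phi> \<le> real N * \<phi>" using \<phi> that by (intro mult_right_mono) auto
    then show "real j * \<phi> + c < pi" using c by simp
  qed
  define T where "T m' i j = (if i \<le> j then sin_binom \<phi> m' (j - i) else 0)" for m' i j :: nat
  show ?case
  proof (cases "r = 0")
    case True
    show ?thesis unfolding tnn_def
    proof (intro allI impI, elim conjE)
      fix s :: nat and f g :: "nat \<Rightarrow> nat"
      assume "f ` {..<s} \<subseteq> {..<r}"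
      then have "s = 0" using True by auto
      then show "0 \<le> square_det s (\<lambda>a b. if f a \<le> g b then sin_binom \<phi> (Suc m) (g b - f a) else 0)"
        by (simp add: square_det_def)
    qed
  next
    case False
    then have mN: "Suc m \<le> N" using Suc.prems by simp
    define M where "M = sin (real (Suc m) * \<phi>)"
    have M: "0 < M" unfolding M_def using mN by (intro sin_multiple_pos[OF \<phi> N\<phi>]) auto
    have rec: "M * s j * T (Suc m) i j = s i * T m i j + s (i + Suc m) * T m (Suc i) j" for i j
    proof (cases "i \<le> j \<and> j \<le> i + Suc m")
      case True
      then obtain k where j: "j = i + k" and k: "k \<le> Suc m" using le_Suc_ex by auto
      have 1: "T m i j = sin (real (Suc m - k) * \<phi>) * sin_binom \<phi> (Suc m) k"
        using sin_binom_absorb(1)[OF \<phi> N\<phi> mN, of k] by (simp add: T_def j)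
      have 2: "T m (Suc i) j = sin (real k * \<phi>) * sin_binom \<phi> (Suc m) k"
      proof (cases k)
        case 0
        then show ?thesis by (simp add: T_def j)
      next
        case (Suc k')
        then show ?thesis using sin_binom_absorb(2)[OF \<phi> N\<phi> mN, of k'] by (simp add: T_def j)
      qed
      have "sin (real (Suc m - k) * \<phi>) = sin (real (Suc m) * \<phi> - real k * \<phi>)"
        using k by (simp add: of_nat_diff algebra_simps)
      moreover have "s (i + Suc m) = sin (real i * \<phi> + real (Suc m) * \<phi> + c)"
        "s j = sin (real i * \<phi> + real k * \<phi> + c)" by (simp_all add: s_def j algebra_simps)
      ultimately have "s i * sin (real (Suc m - k) * \<phi>) + s (i + Suc m) * sin (real k * \<phi>) = M * s j"
        using sin_interpolation[of "real i * \<phi>" c "real (Suc m) * \<phi>" "real k * \<phi>"]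
        by (simp only: s_def M_def)
      then have "(s i * sin (real (Suc m - k) * \<phi>) + s (i + Suc m) * sin (real k * \<phi>)) * sin_binom \<phi> (Suc m) k
          = M * s j * sin_binom \<phi> (Suc m) k" by simp
      moreover have "T (Suc m) i j = sin_binom \<phi> (Suc m) k" by (simp add: T_def j)
      ultimately show ?thesis unfolding 1 2 by (simp add: algebra_simps)
    next
      case False
      then show ?thesis by (auto simp: T_def sin_binom_def)
    qed
    have IH: "tnn (Suc r) (Suc N) (T m)"
      using Suc.IH[of "Suc r"] Suc.prems by (simp add: T_def[abs_def])
    have "tnn r (Suc N) (\<lambda>i j. M * s j * T (Suc m) i j)"
    proof (rule tnn_row_combination[OF IH, where S = "\<lambda>i. {i, Suc i}" and c = "\<lambda>i l. if l = i then s i else s (i + Suc m)"])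
      show "0 \<le> (if l = i then s i else s (i + Suc m))" if "i < r" for i l
        using s_pos[of i] s_pos[of "i + Suc m"] that Suc.prems by (auto intro: less_imp_le)
    qed (auto simp: rec)
    then have "tnn (Suc N) r (\<lambda>j i. M * s j * T (Suc m) i j)" by (rule tnn_transpose)
    then have "tnn (Suc N) r (\<lambda>j i. T (Suc m) i j)"
    proof (rule tnn_row_combination[where S = "\<lambda>j. {j}" and c = "\<lambda>j _. 1 / (M * s j)"])
      fix j i assume j: "j < Suc N"
      then have "0 < M * s j" using M s_pos[of j] by (intro mult_pos_pos) auto
      then have "M \<noteq> 0" "s j \<noteq> 0" by auto
      then show "T (Suc m) i j = (\<Sum>l\<in>{j}. 1 / (M * s j) * (M * s l * T (Suc m) i l))" by simp
    next
      fix j l assume "j < Suc N"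
      then have "0 < M * s j" using M s_pos[of j] by (intro mult_pos_pos) auto
      then show "0 \<le> 1 / (M * s j)" by simp
    qed auto
    then show ?thesis using tnn_transpose[of "Suc N" r "\<lambda>j i. T (Suc m) i j"] by (simp add: T_def)
  qed
qed

text \<open>
  The linear factor of the \<open>q\<close>-binomial theorem with the extreme zero. Multiplying the sum by \<open>sin ((m+1) \<phi>)\<close> and
  splitting this sine by the addition theorem yields the sum for \<open>m\<close>, evaluated at \<open>e\<^bsup>i\<phi>\<^esup> x\<close>, times
  \<open>1 + x e\<^bsup>-im\<phi>\<^esup>\<close>, which vanishes at \<open>x = -e\<^bsup>im\<phi>\<^esup>\<close>.
\<close>
lemma sin_binom_root:
  assumes \<phi>: "0 < \<phi>" "real N * \<phi> < pi" and m: "Suc m \<le> N"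
  shows "(\<Sum>k\<le>Suc m. sin_binom \<phi> (Suc m) k * (- cis (real m * \<phi>)) ^ k) = 0"
proof -
  define x where "x = - cis (real m * \<phi>)"
  define e where "e k = complex_of_real (sin_binom \<phi> (Suc m) k)" for k
  define e' where "e' k = complex_of_real (sin_binom \<phi> m k)" for k
  have sin_split: "complex_of_real (sin (a + b)) = cis a * sin b + cis (- b) * sin a" for a b :: real
    by (simp add: complex_eq_iff sin_add)
  have split: "complex_of_real (sin (real (Suc m) * \<phi>)) =
      cis (real k * \<phi>) * sin (real (Suc m - k) * \<phi>) + cis (real k * \<phi> - real (Suc m) * \<phi>) * sin (real k * \<phi>)"
    if "k \<le> Suc m" for k
    using sin_split[of "real k * \<phi>" "real (Suc m - k) * \<phi>"] that by (simp add: of_nat_diff algebra_simps)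
  have absorb1: "complex_of_real (sin (real (Suc m - k) * \<phi>)) * e k = e' k" for k
    using sin_binom_absorb(1)[OF \<phi> m, of k] by (simp add: e_def e'_def flip: of_real_mult)
  have absorb2: "complex_of_real (sin (real (Suc k) * \<phi>)) * e (Suc k) = e' k" for k
    using sin_binom_absorb(2)[OF \<phi> m, of k] unfolding e_def e'_def by (simp only: of_real_mult[symmetric])
  have "sin (real (Suc m) * \<phi>) * (\<Sum>k\<le>Suc m. e k * x ^ k)
      = (\<Sum>k\<le>Suc m. cis (real k * \<phi>) * (sin (real (Suc m - k) * \<phi>) * e k) * x ^ k)
       + (\<Sum>k\<le>Suc m. cis (real k * \<phi> - real (Suc m) * \<phi>) * (sin (real k * \<phi>) * e k) * x ^ k)"
    unfolding sum_distrib_left sum.distrib[symmetric]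
  proof (intro sum.cong refl)
    fix k assume "k \<in> {..Suc m}"
    then have "k \<le> Suc m" by simp
    show "sin (real (Suc m) * \<phi>) * (e k * x ^ k) =
        cis (real k * \<phi>) * (sin (real (Suc m - k) * \<phi>) * e k) * x ^ k +
        cis (real k * \<phi> - real (Suc m) * \<phi>) * (sin (real k * \<phi>) * e k) * x ^ k"
      unfolding split[OF \<open>k \<le> Suc m\<close>] by (simp only: distrib_right mult.assoc)
  qed
  also have "(\<Sum>k\<le>Suc m. cis (real k * \<phi>) * (sin (real (Suc m - k) * \<phi>) * e k) * x ^ k)
      = (\<Sum>k\<le>m. cis (real k * \<phi>) * e' k * x ^ k)"
    unfolding absorb1 by (simp add: e'_def sin_binom_def)
  also have "(\<Sum>k\<le>Suc m. cis (real k * \<phi> - real (Suc m) * \<phi>) * (sin (real k * \<phi>) * e k) * x ^ k)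
      = (\<Sum>k\<le>m. cis (real (Suc k) * \<phi> - real (Suc m) * \<phi>) * e' k * x ^ Suc k)"
    unfolding sum.atMost_Suc_shift absorb2 by simp
  also have "\<dots> = (\<Sum>k\<le>m. - (cis (real k * \<phi>) * e' k * x ^ k))"
  proof (intro sum.cong refl)
    fix k
    have "cis (real (Suc k) * \<phi> - real (Suc m) * \<phi>) * x = - cis (real k * \<phi>)"
      by (simp add: x_def cis_mult algebra_simps)
    then have "(cis (real (Suc k) * \<phi> - real (Suc m) * \<phi>) * x) * (e' k * x ^ k) = - cis (real k * \<phi>) * (e' k * x ^ k)"
      by simp
    then show "cis (real (Suc k) * \<phi> - real (Suc m) * \<phi>) * e' k * x ^ Suc k = - (cis (real k * \<phi>) * e' k * x ^ k)"
      by (simp add: mult_ac)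
  qed
  finally have "sin (real (Suc m) * \<phi>) * (\<Sum>k\<le>Suc m. e k * x ^ k) = 0"
    by (simp add: sum_negf)
  moreover have "sin (real (Suc m) * \<phi>) > 0" using m by (intro sin_multiple_pos[OF \<phi>]) auto
  ultimately show ?thesis by (simp add: e_def x_def)
qed

section \<open>Sharpness of the angle\<close>

lemma descending_poly_exists:
  fixes c :: "nat \<Rightarrow> real"
  assumes "c 0 \<noteq> 0"
  obtains p where "degree p = n" "\<And>k. k \<le> n \<Longrightarrow> desc_coeff p (int k) = c k"
proof -
  define p where "p = (\<Sum>k\<le>n. monom (c k) (n - k))"
  have coeff: "coeff p i = (if i \<le> n then c (n - i) else 0)" for i
  proof -
    have "coeff p i = (\<Sum>k\<le>n. if n - k = i then c k else 0)"
      by (simp add: p_def coeff_sum)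
    also have "\<dots> = (\<Sum>k\<le>n. if k = n - i then (if i \<le> n then c (n - i) else 0) else 0)"
      by (intro sum.cong) auto
    also have "\<dots> = (if i \<le> n then c (n - i) else 0)" by simp
    finally show ?thesis .
  qed
  have "degree p = n"
    by (rule antisym) (auto simp: coeff assms intro: degree_le le_degree)
  then show thesis by (intro that[of p]) (simp_all add: desc_coeff_nat coeff)
qed

lemma sum_pair_up:
  fixes f :: "nat \<Rightarrow> 'a :: comm_monoid_add" and m :: nat
  shows "(\<Sum>k\<le>2 * m + 1. f k) = (\<Sum>l\<le>m. f (2 * l) + f (2 * l + 1))"
  by (induction m) (simp_all add: ac_simps)

text \<open>
  The coefficients are \<open>e\<^sub>0, 0, e\<^sub>1, 0, \<dots>, e\<^sub>m\<close> for even \<open>n\<close> and \<open>e\<^sub>0, e\<^sub>0, e\<^sub>1, e\<^sub>1, \<dots>, e\<^sub>m, e\<^sub>m\<close> for odd \<open>n\<close>. For odd \<open>n\<close> the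
  factor \<open>z + 1\<close> makes the constant term positive, and it keeps the \<open>n - m = m + 1\<close> shifts of the coefficients of \<open>Q\<close> as rows.
  Taking \<open>\<phi> < \<pi>/(n-1)\<close> strictly keeps all sines in use positive and leaves room for the offset \<open>c\<close>
  of \<open>sin_binom_toeplitz_tnn\<close>.
\<close>
lemma sector_angle_sharp:
  assumes n: "2 \<le> n" and \<beta>: "sector_angle n < \<beta>"
  obtains p z where "degree p = n" "desc_coeff p 0 > 0" "desc_coeff p (int n) > 0"
    "totally_nonneg (hurwitz_mat p)" "poly (map_poly complex_of_real p) z = 0" "z \<noteq> 0" "\<bar>Arg z\<bar> < \<beta>"
proof -
  define m where "m = n div 2"
  have m1: "1 \<le> m" "m \<le> n - 1" using n by (auto simp: m_def)
  then obtain m' where m': "m = Suc m'" using not0_implies_Suc by fastforce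
  \<comment> \<open>The first bound on \<open>\<delta>\<close> keeps \<open>\<phi>\<close> positive, the second one keeps the argument of the zero below \<open>\<beta>\<close>.\<close>
  define \<delta> where "\<delta> = min (pi / (2 * (real n - 1))) ((\<beta> - sector_angle n) / real n)"
  define \<phi> where "\<phi> = pi / (real n - 1) - \<delta>"
  have \<delta>: "0 < \<delta>" "\<delta> \<le> pi / (2 * (real n - 1))" "\<delta> \<le> (\<beta> - sector_angle n) / real n"
    using n \<beta> by (simp_all add: \<delta>_def)
  have n\<delta>: "real n * \<delta> \<le> \<beta> - sector_angle n" using \<delta>(3) n by (simp add: field_simps)
  have "pi / (2 * (real n - 1)) < pi / (real n - 1)" using n by (simp add: field_simps)
  then have \<phi>0: "0 < \<phi>" using \<delta>(2) by (simp add: \<phi>_def)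
  have N\<phi>_eq: "real (n - 1) * \<phi> = pi - real (n - 1) * \<delta>"
    using n by (simp add: \<phi>_def of_nat_diff right_diff_distrib)
  have N\<phi>: "real (n - 1) * \<phi> < pi" unfolding N\<phi>_eq using \<delta>(1) n by simp
  have angle: "pi - real m' * \<phi> < 2 * \<beta>"
  proof -
    have "2 * sector_angle n = pi - real m' * (pi / (real n - 1))"
    proof (cases "odd n")
      case True
      then obtain q where q: "n = 2 * q + 1" by (rule oddE)
      then have "real n = 2 * real m' + 3" using m' by (simp add: m_def)
      then show ?thesis using True n by (simp add: sector_angle_def field_simps)
    next
      case False
      then obtain q where q: "n = 2 * q" by (auto elim: evenE)
      then have "real n = 2 * real m' + 2" using m' by (simp add: m_def)
      then show ?thesis using False n by (simp add: sector_angle_def field_simps)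
    qed
    then have "pi - real m' * \<phi> = 2 * sector_angle n + real m' * \<delta>"
      by (simp add: \<phi>_def right_diff_distrib)
    also have "real m' * \<delta> \<le> real n * \<delta>" using m' m1 \<delta>(1) by (intro mult_right_mono) auto
    finally show ?thesis using n\<delta> \<beta> by linarith
  qed
  define e where "e = sin_binom \<phi> m"
  define c where "c k = (if odd n \<or> even k then e (k div 2) else 0)" for k
  have e_pos: "0 < e k" if "k \<le> m" for k
    unfolding e_def using sin_binom_pos[OF \<phi>0 N\<phi>] that m1 by simp
  have e_0: "e k = 0" if "m < k" for k using that by (simp add: e_def sin_binom_def)
  obtain p where p: "degree p = n" "\<And>k. k \<le> n \<Longrightarrow> desc_coeff p (int k) = c k"
    using descending_poly_exists[of c n] e_pos[of 0] by (auto simp: c_def)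
  have H: "desc_coeff p (2 * int j + 1 - int i) =
      (if odd n \<or> odd i then (if i div 2 \<le> j then e (j - i div 2) else 0) else 0)" for i j
  proof (cases "i div 2 \<le> j")
    case False
    then have "2 * int j + 1 - int i < 0" by linarith
    then show ?thesis using False by (simp add: desc_coeff_def)
  next
    case True
    then have le: "i \<le> 2 * j + 1" by linarith
    define k where "k = 2 * j + 1 - i"
    have k: "2 * int j + 1 - int i = int k" using le by (simp add: k_def of_nat_diff)
    have kd: "k div 2 = j - i div 2" and par: "even k \<longleftrightarrow> odd i" using le unfolding k_def by presburger+
    show ?thesis
    proof (cases "k \<le> n")
      case True
      then show ?thesis using \<open>i div 2 \<le> j\<close> unfolding k p(2)[OF True] by (simp add: c_def kd par)
    next
      case False
      have "e (j - i div 2) = 0" if "odd n \<or> odd i"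
      proof -
        have "m < k div 2" using False that par unfolding m_def by presburger
        then show ?thesis using e_0 kd by simp
      qed
      then show ?thesis using False unfolding k by (auto simp: desc_coeff_def p(1))
    qed
  qed
  define b where "b = (pi - real (n - 1) * \<phi>) / 2"
  have "0 < (pi - x) / 2 \<and> x + (pi - x) / 2 < pi" if "x < pi" for x :: real
    using that by (simp add: field_simps)
  then have "0 < b" "real (n - 1) * \<phi> + b < pi" using N\<phi> unfolding b_def by blast+
  from sin_binom_toeplitz_tnn[OF \<phi>0 this, of "n - m" m]
  have T: "tnn (n - m) n (\<lambda>i j. if i \<le> j then e (j - i) else 0)"
    using n m1 unfolding e_def by simp
  have "tnn n n (\<lambda>i j. desc_coeff p (2 * int j + 1 - int i))"
  proof (rule tnn_row_combination[OF T, where S = "\<lambda>i. if odd n \<or> odd i then {i div 2} else {}" and c = "\<lambda>_ _. 1"])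
    show "(if odd n \<or> odd i then {i div 2} else {}) \<subseteq> {..<n - m}" if "i < n" for i
    proof -
      have "i div 2 < n - m" if "odd n \<or> odd i" using \<open>i < n\<close> that unfolding m_def by presburger
      then show ?thesis by simp
    qed
    show "l \<le> l'" if "i < i'" "l \<in> (if odd n \<or> odd i then {i div 2} else {})"
      "l' \<in> (if odd n \<or> odd i' then {i' div 2} else {})" for i i' l l' :: nat
      using that by (auto split: if_splits intro: div_le_mono)
  qed (auto simp: H)
  then have tnn: "totally_nonneg (hurwitz_mat p)" using tnn_hurwitz_iff[of p] p(1) by simp
  define z where "z = cis ((pi - real m' * \<phi>) / 2)"
  have m'\<phi>: "0 \<le> real m' * \<phi>" "real m' * \<phi> < pi"
  proof -
    show "0 \<le> real m' * \<phi>" using \<phi>0 by simp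
    have "real m' * \<phi> \<le> real (n - 1) * \<phi>" using m' m1 \<phi>0 by (intro mult_right_mono) auto
    then show "real m' * \<phi> < pi" using N\<phi> by simp
  qed
  have Arg: "Arg z = (pi - real m' * \<phi>) / 2"
    unfolding z_def using m'\<phi> by (intro cis_Arg_unique) (auto simp: sgn_eq)
  define y where "y = inverse z"
  have y2: "y ^ 2 = - cis (real m' * \<phi>)"
  proof -
    have "y ^ 2 = cis (real m' * \<phi> - pi)" by (simp add: y_def z_def power2_eq_square cis_mult)
    then show ?thesis by (simp add: cis_divide[symmetric])
  qed
  have "(\<Sum>k\<le>n. desc_coeff p (int k) * y ^ k) = (\<Sum>k\<le>n. c k * y ^ k)" using p(2) by simp
  also have "\<dots> = (\<Sum>k\<le>2 * m + 1. c k * y ^ k)"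
  proof (cases "odd n")
    case True
    then have "n = 2 * m + 1" unfolding m_def by presburger
    then show ?thesis by simp
  next
    case False
    then have "n = 2 * m" "c (2 * m + 1) = 0" unfolding m_def c_def by (presburger, simp)
    then show ?thesis by simp
  qed
  also have "\<dots> = (\<Sum>l\<le>m. c (2 * l) * y ^ (2 * l) + c (2 * l + 1) * y ^ (2 * l + 1))"
    by (rule sum_pair_up)
  also have "\<dots> = (\<Sum>l\<le>m. (1 + (if odd n then y else 0)) * (e l * (- cis (real m' * \<phi>)) ^ l))"
  proof (intro sum.cong refl)
    fix l
    have "y ^ (2 * l) = (- cis (real m' * \<phi>)) ^ l" by (simp only: power_mult y2)
    then show "c (2 * l) * y ^ (2 * l) + c (2 * l + 1) * y ^ (2 * l + 1) =
        (1 + (if odd n then y else 0)) * (e l * (- cis (real m' * \<phi>)) ^ l)"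
      by (simp only: power_add power_one_right) (simp add: c_def distrib_right)
  qed
  also have "\<dots> = (1 + (if odd n then y else 0)) * (\<Sum>l\<le>m. e l * (- cis (real m' * \<phi>)) ^ l)"
    by (simp only: sum_distrib_left)
  also have "(\<Sum>l\<le>m. e l * (- cis (real m' * \<phi>)) ^ l) = 0"
    unfolding e_def m' using sin_binom_root[OF \<phi>0 N\<phi>, of m'] m1 m' by simp
  finally have root: "(\<Sum>k\<le>n. desc_coeff p (int k) * y ^ k) = 0" by simp
  have z0: "z \<noteq> 0" by (simp add: z_def)
  show thesis
  proof (rule that[of p z])
    show "degree p = n" by (rule p)
    show "desc_coeff p 0 > 0" using p(2)[of 0] e_pos[of 0] by (simp add: c_def)
    have "c n = e m" by (auto simp: c_def m_def)
    then show "desc_coeff p (int n) > 0" using p(2)[of n] e_pos[of m] by simp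
    show "poly (map_poly complex_of_real p) z = 0"
      using poly_complex_descending[OF z0, of p] root p(1) by (simp add: y_def)
    show "\<bar>Arg z\<bar> < \<beta>" using Arg angle m'\<phi> by simp
  qed (rule tnn z0)+
qed

theorem theorem2p1:
  fixes n :: nat
  assumes "n \<ge> 2"
  shows "(\<forall>p :: real poly.
            degree p = n \<and> desc_coeff p 0 > 0 \<and> desc_coeff p (int n) > 0
              \<and> totally_nonneg (hurwitz_mat p) \<longrightarrow>
            \<not> (\<exists>z :: complex. poly (map_poly complex_of_real p) z = 0
                  \<and> z \<noteq> 0 \<and> \<bar>Arg z\<bar> < sector_angle n))
       \<and> (\<forall>\<beta> :: real. \<beta> > sector_angle n \<longrightarrow>
            (\<exists>p :: real poly.
               degree p = n \<and> desc_coeff p 0 > 0 \<and> desc_coeff p (int n) > 0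
                 \<and> totally_nonneg (hurwitz_mat p)
                 \<and> (\<exists>z :: complex. poly (map_poly complex_of_real p) z = 0
                      \<and> z \<noteq> 0 \<and> \<bar>Arg z\<bar> < \<beta>)))"
proof (intro conjI allI impI notI; (elim exE conjE)?)
  fix p :: "real poly" and z :: complex
  assume "degree p = n" "desc_coeff p 0 > 0" "desc_coeff p (int n) > 0"
    "totally_nonneg (hurwitz_mat p)"
    "poly (map_poly complex_of_real p) z = 0" "z \<noteq> 0" "\<bar>Arg z\<bar> < sector_angle n"
  then show False using sector_root_free[of p n z] assms by blast
next
  fix \<beta> :: real
  assume "\<beta> > sector_angle n"
  from sector_angle_sharp[OF assms this]
  show "\<exists>p :: real poly. degree p = n \<and> desc_coeff p 0 > 0 \<and> desc_coeff p (int n) > 0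
      \<and> totally_nonneg (hurwitz_mat p)
      \<and> (\<exists>z :: complex. poly (map_poly complex_of_real p) z = 0 \<and> z \<noteq> 0 \<and> \<bar>Arg z\<bar> < \<beta>)"
    by metis
qed

end
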